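(* Let $\mathcal{I}$ be an ideal. The following are equivalent: (a) $\mathcal{I}$ is unboring; (b) there is a Hausdorff space in $\mathrm{FinBW}(\mathcal{I})$ which is not a boring space. If additionally the continuum hypothesis (CH) holds, then (a) and (b) are also equivalent to each of: (c) there is an uncountable Mr\'owka space in $\mathrm{FinBW}(\mathcal{I})$; (d) there is an uncountable separable space in $\mathrm{FinBW}(\mathcal{I})$.
   Context: An ideal on an infinite countable set $X$ is a family $\mathcal{I}\subseteq\mathcal{P}(X)$ closed under subsets and finite unions, containing all finite subsets of $X$, with $X\notin\mathcal{I}$; we write $\bigcup\mathcal{I}=X$. $\mathrm{Fin}$ is the ideal of finite subsets of $\omega$. For $Y\subseteq X$, $\mathcal{I}|Y=\{A\cap Y: A\in\mathcal{I}\}$. A topological space $X$ is in $\mathrm{FinBW}(\mathcal{I})$ ($\mathcal{I}$ an ideal on a countable set $M$) if $X$ is Hausdorff and for every sequence $(x_n)_{n\in M}$ in $X$ there is $A\subseteq M$, $A\notin\mathcal{I}$, such that $(x_n)_{n\in A}$ converges in $X$ (i.e., there is $x\in X$ with $\{n\in A: x_n\notin U\}$ finite for every open neighbourhood $U$ of $x$). For $A\subseteq X\times Y$ and $x\in X$ let $A_{(x)}=\{y:(x,y)\in A\}$. $\mathrm{Fin}^2$ is the ideal on $\omega^2$ of all $A$ with $\{n: A_{(n)}\text{ infinite}\}$ finite. $\mathcal{BI}$ is the ideal on $\omega^3$ of all $A\subseteq\omega^3$ for which there is $k$ such that $A_{(i)}\in\mathrm{Fin}^2$ for all $i<k$ and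 $A_{(i)}$ is finite for all $i\ge k$ (here $A_{(i)}=\{(j,l):(i,j,l)\in A\}$). For ideals $\mathcal{I},\mathcal{J}$ write $\mathcal{I}\sqsubseteq\mathcal{J}$ if there is a bijection $f:\bigcup\mathcal{J}\to\bigcup\mathcal{I}$ with $f^{-1}[A]\in\mathcal{J}$ for all $A\in\mathcal{I}$. An ideal $\mathcal{I}$ is boring if $\mathcal{BI}\sqsubseteq\mathcal{I}$, and unboring otherwise. A topological space $X$ is boring if it is sequentially compact and there is a finite $F\subseteq X$ such that every convergent sequence in $X$ with infinitely many distinct values (a "surjective" convergent sequence onto an infinite set) converges to some point of $F$. An almost disjoint (AD) family is a family of infinite subsets of $\omega$ with pairwise finite intersections. For an infinite AD family $\mathcal{A}$, $\Phi(\mathcal{A})$ is the space with underlying set $\omega\cup\mathcal{A}\cup\{\infty\}$ where points of $\omega$ are isolated, basic neighbourhoods of $A\in\mathcal{A}$ are $\{A\}\cup(A\setminus F)$ with $F\subseteq\omega$ finite, and basic neighbourhoods of $\infty$ are $\{\infty\}\cup(\mathcal{A}\setminus G)\cup(\omega\setminus(F\cup\bigcup G))$ with $F\subseteq\omega$, $G\subseteq\mathcal{A}$ finite. A Mr\'owka space is a space of the form $\Phi(\mathcal{A})$ for some infinite AD family $\mathcal{A}$. *)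

theory Defs
  imports "HOL-Analysis.Analysis" "HOL-Library.Equipollence"
begin

definition is_ideal :: "'a set set \<Rightarrow> 'a set \<Rightarrow> bool" where
  "is_ideal I X \<longleftrightarrow> countable X \<and> infinite X \<and> I \<subseteq> Pow X
     \<and> (\<forall>A\<in>I. \<forall>B. B \<subseteq> A \<longrightarrow> B \<in> I)
     \<and> (\<forall>A\<in>I. \<forall>B\<in>I. A \<union> B \<in> I)
     \<and> (\<forall>F. F \<subseteq> X \<and> finite F \<longrightarrow> F \<in> I)
     \<and> X \<notin> I"

definition sect :: "('a \<times> 'b) set \<Rightarrow> 'a \<Rightarrow> 'b set" where
  "sect A x = {y. (x, y) \<in> A}"

definition Fin2 :: "(nat \<times> nat) set set" where
  "Fin2 = {A. finite {n. infinite (sect A n)}}"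

definition BI :: "(nat \<times> nat \<times> nat) set set" where
  "BI = {A. \<exists>k. (\<forall>i<k. sect A i \<in> Fin2) \<and> (\<forall>i\<ge>k. finite (sect A i))}"

definition ideal_below :: "'a set set \<Rightarrow> 'a set \<Rightarrow> 'b set set \<Rightarrow> 'b set \<Rightarrow> bool" where
  "ideal_below I XI J XJ \<longleftrightarrow>
     (\<exists>f. bij_betw f XJ XI \<and> (\<forall>A\<in>I. f -` A \<inter> XJ \<in> J))"

definition boring_ideal :: "'a set set \<Rightarrow> 'a set \<Rightarrow> bool" where
  "boring_ideal I X \<longleftrightarrow> ideal_below BI UNIV I X"

definition unboring_ideal :: "'a set set \<Rightarrow> 'a set \<Rightarrow> bool" where
  "unboring_ideal I X \<longleftrightarrow> \<not> boring_ideal I X"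

definition converges_on :: "'b topology \<Rightarrow> ('a \<Rightarrow> 'b) \<Rightarrow> 'a set \<Rightarrow> 'b \<Rightarrow> bool" where
  "converges_on T x A l \<longleftrightarrow> l \<in> topspace T \<and>
     (\<forall>U. openin T U \<and> l \<in> U \<longrightarrow> finite {n\<in>A. x n \<notin> U})"

definition FinBW :: "'b topology \<Rightarrow> 'a set set \<Rightarrow> 'a set \<Rightarrow> bool" where
  "FinBW T I M \<longleftrightarrow> Hausdorff_space T \<and>
     (\<forall>x. (\<forall>n\<in>M. x n \<in> topspace T) \<longrightarrow>
        (\<exists>A. A \<subseteq> M \<and> A \<notin> I \<and> (\<exists>l. converges_on T x A l)))"

definition seq_compact_space :: "'b topology \<Rightarrow> bool" where
  "seq_compact_space T \<longleftrightarrow>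
     (\<forall>x::nat \<Rightarrow> 'b. range x \<subseteq> topspace T \<longrightarrow>
        (\<exists>r l. strict_mono r \<and> limitin T (x \<circ> r) l sequentially))"

definition boring_space :: "'b topology \<Rightarrow> bool" where
  "boring_space T \<longleftrightarrow> seq_compact_space T \<and>
     (\<exists>F. finite F \<and> F \<subseteq> topspace T \<and>
        (\<forall>x::nat \<Rightarrow> 'b. range x \<subseteq> topspace T \<and> infinite (range x)
            \<and> (\<exists>l. limitin T x l sequentially)
          \<longrightarrow> (\<exists>l\<in>F. limitin T x l sequentially)))"

definition AD_family :: "nat set set \<Rightarrow> bool" where
  "AD_family \<A> \<longleftrightarrow> (\<forall>A\<in>\<A>. infinite A) \<and>
     (\<forall>A\<in>\<A>. \<forall>B\<in>\<A>. A \<noteq> B \<longrightarrow> finite (A \<inter> B))"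

datatype phi_point = PtN nat | PtA "nat set" | PtInf

definition mrowka :: "nat set set \<Rightarrow> phi_point topology" where
  "mrowka \<A> = topology_generated_by
     ((\<lambda>n. {PtN n}) ` UNIV
      \<union> {insert (PtA A) (PtN ` (A - F)) | A F. A \<in> \<A> \<and> finite F}
      \<union> {insert PtInf (PtA ` (\<A> - G) \<union> PtN ` (UNIV - (F \<union> \<Union>G)))
          | F G. finite F \<and> finite G \<and> G \<subseteq> \<A>})"

definition CH :: bool where
  "CH \<longleftrightarrow> (\<forall>S::real set. uncountable S \<longrightarrow> S \<approx> (UNIV::real set))"

end

theory Submission
  imports Defs
begin

text \<open>
  An ideal is boring as soon as its ground set splits into countably many pieces on which it looks
  like \<open>Fin\<^sup>2\<close> and it contains every set meeting each piece finitely. Hence, if the ideal is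
  unboring, \<open>g\<close> is a map with fibres in the ideal, and \<open>P n\<close> are countably many sets such that no
  positive set is mapped finite-to-one into a single \<open>P n\<close>, then there is a positive set on which
  \<open>g\<close> is finite-to-one and almost avoids every \<open>P n\<close>. For a countable almost disjoint
  family this gives convergence to \<open>\<infinity>\<close> in the Mrowka space. Under CH the family can be extended along \<open>\<omega>\<^sub>1\<close>, each step taking care of one
  sequence. Conversely, infinitely many disjoint convergent sequences with different limits,
  each point repeated infinitely often, form a sequence indexed by \<open>\<omega>\<^sup>3\<close> that converges on no
  \<open>BI\<close>-positive set; and a separable boring Hausdorff space is countable, because its points
  outside a finite set are isolated.
\<close>

section \<open>Ideals\<close>

lemma ideal_subset: "is_ideal I X \<Longrightarrow> A \<in> I \<Longrightarrow> B \<subseteq> A \<Longrightarrow> B \<in> I"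
  by (auto simp: is_ideal_def)

lemma ideal_Un: "is_ideal I X \<Longrightarrow> A \<in> I \<Longrightarrow> B \<in> I \<Longrightarrow> A \<union> B \<in> I"
  by (auto simp: is_ideal_def)

lemma ideal_finite: "is_ideal I X \<Longrightarrow> F \<subseteq> X \<Longrightarrow> finite F \<Longrightarrow> F \<in> I"
  by (auto simp: is_ideal_def)

lemma ideal_UN:
  assumes "is_ideal I X" "finite K" "\<And>k. k \<in> K \<Longrightarrow> A k \<in> I"
  shows "(\<Union>k\<in>K. A k) \<in> I"
  using assms(2,3)
proof (induction K rule: finite_induct)
  case empty
  then show ?case using ideal_finite[OF assms(1), of "{}"] by simp
next
  case (insert k K)
  then show ?case using ideal_Un[OF assms(1)] by simp
qed

lemma ideal_Diff_finite:
  assumes "is_ideal I X" "E \<notin> I" "F \<subseteq> X" "finite F"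
  shows "E - F \<notin> I"
proof
  assume "E - F \<in> I"
  then have "(E - F) \<union> F \<in> I" using ideal_Un ideal_finite assms by metis
  then show False using ideal_subset[OF assms(1), of "(E - F) \<union> F" E] assms(2) by blast
qed

section \<open>Finite-to-one maps\<close>

definition fin_to_one :: "('a \<Rightarrow> 'b) \<Rightarrow> 'a set \<Rightarrow> bool" where
  "fin_to_one g E \<longleftrightarrow> (\<forall>v. finite {x\<in>E. g x = v})"

lemma fin_to_one_subset: "fin_to_one g E \<Longrightarrow> D \<subseteq> E \<Longrightarrow> fin_to_one g D"
proof (unfold fin_to_one_def, intro allI)
  fix v assume "\<forall>v. finite {x\<in>E. g x = v}" "D \<subseteq> E"
  moreover from this have "{x\<in>D. g x = v} \<subseteq> {x\<in>E. g x = v}" by auto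
  ultimately show "finite {x\<in>D. g x = v}" using finite_subset by blast
qed

lemma fin_to_one_finite_preimage:
  assumes "fin_to_one g E" "finite V"
  shows "finite {x\<in>E. g x \<in> V}"
proof -
  have "{x\<in>E. g x \<in> V} = (\<Union>v\<in>V. {x\<in>E. g x = v})" by auto
  then show ?thesis using assms by (auto simp: fin_to_one_def)
qed

lemma fin_to_one_infinite_image:
  assumes "fin_to_one g E" "infinite E"
  shows "infinite (g ` E)"
proof
  assume "finite (g ` E)"
  then have "finite {x\<in>E. g x \<in> g ` E}" using assms(1) fin_to_one_finite_preimage by blast
  moreover have "{x\<in>E. g x \<in> g ` E} = E" by auto
  ultimately show False using assms(2) by simp
qed

lemma fin_to_one_inj_on:
  assumes "inj_on g E" shows "fin_to_one g E"
  unfolding fin_to_one_def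
proof
  fix v
  have "inj_on g {x\<in>E. g x = v}" using assms by (rule inj_on_subset) auto
  moreover have "g ` {x\<in>E. g x = v} \<subseteq> {v}" by auto
  ultimately show "finite {x\<in>E. g x = v}" by (meson finite.emptyI finite.insertI inj_on_finite)
qed

text \<open>An embedding into the index set of \<open>BI\<close> is enough: redefining it on an infinite member
  of the ideal makes it surjective.\<close>

lemma boring_ideal_if_injection:
  fixes f :: "'a \<Rightarrow> nat \<times> nat \<times> nat"
  assumes I: "is_ideal I X" and P: "P \<in> I" "infinite P" and f: "inj_on f X"
    and BI: "\<And>A. A \<in> BI \<Longrightarrow> {x\<in>X. f x \<in> A} \<in> I"
  shows "boring_ideal I X"
proof -
  have PX: "P \<subseteq> X" and cX: "countable X" using I P by (auto simp: is_ideal_def)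
  define Q where "Q = - f ` (X - P)"
  have "f ` P \<inter> f ` (X - P) = {}"
    using inj_on_image_Int[OF f PX, of "X - P"] by (simp add: Int_Diff)
  then have "f ` P \<subseteq> Q" unfolding Q_def by blast
  then have "infinite Q"
    using P(2) f PX by (metis finite_imageD finite_subset inj_on_subset)
  moreover have "countable P" using cX PX countable_subset by blast
  ultimately obtain h where h: "bij_betw h P Q"
    using P(2) bij_betw_trans[OF to_nat_on_infinite bij_betw_from_nat_into[of Q]] by blast
  define g where "g x = (if x \<in> P then h x else f x)" for x
  have "bij_betw g (P \<union> (X - P)) (Q \<union> f ` (X - P))"
  proof (rule bij_betw_combine)
    show "bij_betw g P Q" using h by (simp add: g_def cong: bij_betw_cong)
    have "bij_betw f (X - P) (f ` (X - P))"
      using f by (meson bij_betw_imageI inj_on_diff)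
    then show "bij_betw g (X - P) (f ` (X - P))"
      by (subst bij_betw_cong[where g = f]) (auto simp: g_def)
    show "Q \<inter> f ` (X - P) = {}" by (auto simp: Q_def)
  qed
  moreover have "P \<union> (X - P) = X" "Q \<union> f ` (X - P) = UNIV" using PX by (auto simp: Q_def)
  ultimately have "bij_betw g X UNIV" by simp
  moreover have "g -` A \<inter> X \<in> I" if "A \<in> BI" for A
  proof -
    \<comment> \<open>\<open>g\<close> and \<open>f\<close> disagree only on \<open>P\<close>, so
      the preimage under \<open>g\<close> is covered by the one under \<open>f\<close> together with
      a member of \<open>I\<close>.\<close>
    have "{x\<in>X. f x \<in> A} \<union> P \<in> I" using BI[OF that] P(1) ideal_Un[OF I] by blast
    then show ?thesis by (rule ideal_subset[OF I]) (auto simp: g_def split: if_splits)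
  qed
  ultimately show ?thesis unfolding boring_ideal_def ideal_below_def by blast
qed

text \<open>Supplies the infinite member that \<open>boring_ideal_if_injection\<close> needs. If all
  members of \<open>I\<close> were finite, a transversal of the fibres of \<open>d\<close> would be
  finite, since \<open>d\<close> is injective on it; likewise for \<open>c\<close> inside one fibre
  of \<open>d\<close>. So \<open>X\<close> would be a finite union of finite sets.\<close>

lemma infinite_member_if_fibres:
  fixes c :: "'a \<Rightarrow> 'c" and d :: "'a \<Rightarrow> 'd"
  assumes I: "is_ideal I X"
    and fib: "\<And>u v. {x\<in>X. d x = u \<and> c x = v} \<in> I"
    and c: "\<And>u E. E \<subseteq> {x\<in>X. d x = u} \<Longrightarrow> fin_to_one c E \<Longrightarrow> E \<in> I"
    and d: "\<And>E. E \<subseteq> X \<Longrightarrow> fin_to_one d E \<Longrightarrow> E \<in> I"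
  shows "\<exists>P\<in>I. infinite P"
proof (rule ccontr)
  assume "\<not> ?thesis"
  then have fin: "finite P" if "P \<in> I" for P using that by blast
  have "finite (d ` X)"
  proof -
    obtain E where E: "E \<subseteq> X" "inj_on d E" "d ` X = d ` E"
      using subset_image_inj[of "d ` X" d X] by auto
    then show ?thesis using d fin fin_to_one_inj_on by (metis finite_imageI)
  qed
  moreover have "finite {x\<in>X. d x = u}" for u
  proof -
    obtain E where E: "E \<subseteq> {x\<in>X. d x = u}" "inj_on c E" "c ` {x\<in>X. d x = u} = c ` E"
      using subset_image_inj[of "c ` {x\<in>X. d x = u}" c "{x\<in>X. d x = u}"] by auto
    then have "finite (c ` {x\<in>X. d x = u})" using fin[OF c[OF E(1) fin_to_one_inj_on[OF E(2)]]] by simp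
    then have "finite (\<Union>v\<in>c ` {x\<in>X. d x = u}. {x\<in>X. d x = u \<and> c x = v})"
      by (rule finite_UN_I) (rule fin[OF fib])
    then show ?thesis by (rule rev_finite_subset) auto
  qed
  moreover have "X = (\<Union>u\<in>d ` X. {x\<in>X. d x = u})" by auto
  ultimately have "finite X" using finite_UN_I[of "d ` X" "\<lambda>u. {x\<in>X. d x = u}"] by simp
  then show False using I by (auto simp: is_ideal_def)
qed

text \<open>The layers of \<open>BI\<close> in abstract form: \<open>d\<close> gives the first
  coordinate, \<open>c\<close> the second, and an enumeration of \<open>X\<close> the third, which
  makes the map injective. A member of \<open>BI\<close> splits into finitely many layers, handled
  by \<open>fib\<close> and \<open>c\<close>, and a rest on which \<open>d\<close> is
  finite-to-one.\<close>

lemma boring_ideal_if_fibres: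
  fixes c :: "'a \<Rightarrow> 'c" and d :: "'a \<Rightarrow> nat"
  assumes I: "is_ideal I X"
    and fib: "\<And>u v. {x\<in>X. d x = u \<and> c x = v} \<in> I"
    and c: "\<And>u E. E \<subseteq> {x\<in>X. d x = u} \<Longrightarrow> fin_to_one c E \<Longrightarrow> E \<in> I"
    and d: "\<And>E. E \<subseteq> X \<Longrightarrow> fin_to_one d E \<Longrightarrow> E \<in> I"
  shows "boring_ideal I X"
proof -
  obtain P where P: "P \<in> I" "infinite P"
    using infinite_member_if_fibres[where c = c and d = d, OF I] assms by blast
  have cX: "countable X" using I by (auto simp: is_ideal_def)
  define e where "e = to_nat_on X"
  define b where "b = to_nat_on (c ` X)"
  have e: "inj_on e X" using cX by (simp add: e_def inj_on_to_nat_on)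
  have b: "inj_on b (c ` X)" using cX by (simp add: b_def inj_on_to_nat_on)
  define f where "f x = (d x, b (c x), e x)" for x
  show ?thesis
  proof (rule boring_ideal_if_injection[OF I P])
    show "inj_on f X" using e by (auto simp: f_def inj_on_def)
    fix A :: "(nat \<times> nat \<times> nat) set"
    assume "A \<in> BI"
    then obtain k where k: "\<And>i. i < k \<Longrightarrow> sect A i \<in> Fin2" "\<And>i. i \<ge> k \<Longrightarrow> finite (sect A i)"
      by (auto simp: BI_def)
    have small: "{x\<in>X. f x \<in> A \<and> d x = i} \<in> I" if "i < k" for i
    proof -
      \<comment> \<open>The finitely many infinite columns of this layer. Their preimages are
        fibres, hence in \<open>I\<close>; away from them \<open>c\<close> is finite-to-one.\<close>
      define V where "V = {n. infinite (sect (sect A i) n)}"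
      have V: "finite V" using k(1)[OF that] by (simp add: Fin2_def V_def)
      have one: "{x\<in>X. d x = i \<and> b (c x) = n} \<in> I" for n
      proof -
        have "{x\<in>X. d x = i \<and> b (c x) = n} \<subseteq> {x\<in>X. d x = i \<and> c x = inv_into (c ` X) b n}"
          using b by auto
        then show ?thesis using fib ideal_subset[OF I] by blast
      qed
      have "(\<Union>n\<in>V. {x\<in>X. d x = i \<and> b (c x) = n}) \<in> I"
        by (rule ideal_UN[OF I V one])
      moreover have "{x\<in>X. f x \<in> A \<and> d x = i \<and> b (c x) \<notin> V} \<in> I" (is "?E \<in> I")
      proof (rule c[of _ i])
        show "fin_to_one c ?E"
          unfolding fin_to_one_def
        proof
          fix v
          have "finite {x\<in>?E. c x = v}"
          proof (cases "b v \<in> V")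
            case False
            have "e ` {x\<in>?E. c x = v} \<subseteq> sect (sect A i) (b v)"
              by (auto simp: sect_def f_def)
            moreover have "finite (sect (sect A i) (b v))" using False by (simp add: V_def)
            moreover have "inj_on e {x\<in>?E. c x = v}" by (rule inj_on_subset[OF e]) auto
            ultimately show ?thesis using inj_on_finite by blast
          next
            case True
            then have "{x\<in>?E. c x = v} = {}" by auto
            then show ?thesis by (simp only: finite.emptyI)
          qed
          then show "finite {x\<in>?E. c x = v}" .
        qed
      qed auto
      ultimately have "(\<Union>n\<in>V. {x\<in>X. d x = i \<and> b (c x) = n}) \<union> ?E \<in> I"
        by (rule ideal_Un[OF I])
      then show ?thesis by (rule ideal_subset[OF I]) auto
    qed
    have "(\<Union>i\<in>{..<k}. {x\<in>X. f x \<in> A \<and> d x = i}) \<in> I"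
      by (rule ideal_UN[OF I]) (auto intro: small)
    moreover have "{x\<in>X. f x \<in> A \<and> d x \<ge> k} \<in> I" (is "?E \<in> I")
    proof (rule d)
      show "fin_to_one d ?E"
        unfolding fin_to_one_def
      proof
        fix v
        show "finite {x\<in>?E. d x = v}"
        proof (cases "v \<ge> k")
          case True
          have "(\<lambda>x. (b (c x), e x)) ` {x\<in>?E. d x = v} \<subseteq> sect A v"
            by (auto simp: sect_def f_def)
          moreover have "inj_on (\<lambda>x. (b (c x), e x)) {x\<in>?E. d x = v}"
            using e by (auto simp: inj_on_def)
          ultimately show ?thesis using k(2)[OF True] inj_on_finite by blast
        next
          case False
          then have "{x\<in>?E. d x = v} = {}" by auto
          then show ?thesis by (simp only: finite.emptyI)
        qed
      qed
    qed auto
    ultimately have "(\<Union>i\<in>{..<k}. {x\<in>X. f x \<in> A \<and> d x = i}) \<union> ?E \<in> I"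
      by (rule ideal_Un[OF I])
    then show "{x\<in>X. f x \<in> A} \<in> I" by (rule ideal_subset[OF I]) auto
  qed
qed

text \<open>If no such positive \<open>E\<close> existed, sorting the points by the first
  \<open>P n\<close> containing \<open>g x\<close> would satisfy the hypotheses of
  \<open>boring_ideal_if_fibres\<close> and make \<open>I\<close> boring.\<close>

lemma unboring_ideal_selection:
  fixes g :: "'a \<Rightarrow> 'p" and P :: "nat \<Rightarrow> 'p set"
  assumes I: "is_ideal I X" and unb: "unboring_ideal I X"
    and fib: "\<And>v. {x\<in>X. g x = v} \<in> I"
    and P: "\<And>n E. E \<subseteq> X \<Longrightarrow> g ` E \<subseteq> P n \<Longrightarrow> fin_to_one g E \<Longrightarrow> E \<in> I"
  obtains E where "E \<subseteq> X" "E \<notin> I" "fin_to_one g E" "\<And>n. finite {x\<in>E. g x \<in> P n}"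
proof (rule ccontr)
  assume "\<not> thesis"
  with that have none: "E \<in> I"
    if "E \<subseteq> X" "fin_to_one g E" "\<And>n. finite {x\<in>E. g x \<in> P n}" for E
    using that by blast
  \<comment> \<open>The value 0 is reserved for points whose image lies in no \<open>P n\<close>;
    hence the shift by \<open>Suc\<close>.\<close>
  define d where "d x = (if \<exists>n. g x \<in> P n then Suc (LEAST n. g x \<in> P n) else 0)" for x
  have d0: "d x = 0 \<longleftrightarrow> (\<forall>n. g x \<notin> P n)" for x by (auto simp: d_def)
  have dS: "g x \<in> P n" if "d x = Suc n" for x n
    using that LeastI_ex[of "\<lambda>n. g x \<in> P n"] by (auto simp: d_def split: if_splits)
  have dle: "d x \<le> Suc n" if "g x \<in> P n" for x n
    using that Least_le[of "\<lambda>n. g x \<in> P n"] by (auto simp: d_def)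
  have "boring_ideal I X"
  proof (rule boring_ideal_if_fibres[OF I, where d = d and c = g])
    show "{x\<in>X. d x = u \<and> g x = v} \<in> I" for u v
      by (rule ideal_subset[OF I fib[of v]]) auto
    show "E \<in> I" if E: "E \<subseteq> {x\<in>X. d x = u}" "fin_to_one g E" for u E
    proof (cases u)
      case 0
      have empty: "{x\<in>E. g x \<in> P n} = {}" for n using E(1) 0 d0 by auto
      show ?thesis by (rule none) (use E empty in \<open>auto simp: empty\<close>)
    next
      case (Suc n)
      then show ?thesis using P[of E n] E dS by auto
    qed
    show "E \<in> I" if E: "E \<subseteq> X" "fin_to_one d E" for E
    proof (rule none[OF E(1)])
      \<comment> \<open>\<open>d x\<close> depends on \<open>g x\<close> only, so each fibre of
        \<open>g\<close> lies inside one fibre of \<open>d\<close>.\<close>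
      show "fin_to_one g E"
        unfolding fin_to_one_def
      proof
        fix v
        show "finite {x\<in>E. g x = v}"
        proof (cases "\<exists>x0\<in>E. g x0 = v")
          case True
          then obtain x0 where "g x0 = v" by blast
          then have "{x\<in>E. g x = v} \<subseteq> {x\<in>E. d x = d x0}" by (auto simp: d_def)
          moreover have "finite {x\<in>E. d x = d x0}" using E(2) by (simp add: fin_to_one_def)
          ultimately show ?thesis by (rule finite_subset)
        next
          case False
          then have "{x\<in>E. g x = v} = {}" by auto
          then show ?thesis by (simp only: finite.emptyI)
        qed
      qed
      \<comment> \<open>A value in \<open>P n\<close> forces \<open>d x \<le> Suc n\<close>, which
        leaves finitely many pieces, each meeting \<open>E\<close> finitely.\<close>
      show "finite {x\<in>E. g x \<in> P n}" for n
      proof (rule finite_subset)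
        show "finite {x\<in>E. d x \<in> {..Suc n}}" using E(2) fin_to_one_finite_preimage by blast
      qed (use dle in auto)
    qed
  qed
  then show False using unb by (simp add: unboring_ideal_def)
qed

section \<open>Boring spaces\<close>

lemma boring_spaceE:
  assumes "boring_space T"
  obtains F where "finite F" "F \<subseteq> topspace T"
    "\<And>(x::nat \<Rightarrow> 'b) l. range x \<subseteq> topspace T \<Longrightarrow> infinite (range x) \<Longrightarrow>
      limitin T x l sequentially \<Longrightarrow> \<exists>l\<in>F. limitin T x l sequentially"
proof -
  obtain F where "finite F" "F \<subseteq> topspace T" and
    lim: "\<forall>x::nat \<Rightarrow> 'b. range x \<subseteq> topspace T \<and> infinite (range x)
            \<and> (\<exists>l. limitin T x l sequentially)
          \<longrightarrow> (\<exists>l\<in>F. limitin T x l sequentially)"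
    using assms unfolding boring_space_def by (elim conjE exE) (rule that)
  show thesis
  proof (rule that)
    fix x :: "nat \<Rightarrow> 'b" and l
    assume "range x \<subseteq> topspace T" "infinite (range x)" "limitin T x l sequentially"
    then show "\<exists>l\<in>F. limitin T x l sequentially" using lim by metis
  qed fact+
qed

section \<open>Convergence along index sets and convergent sequences\<close>

lemma eventually_sequentially_iff_finite:
  "eventually P sequentially \<longleftrightarrow> finite {n. \<not> P n}"
  by (simp add: cofinite_eq_sequentially[symmetric] eventually_cofinite)

lemma converges_on_image:
  assumes "converges_on T (x \<circ> e) A l"
  shows "converges_on T x (e ` A) l"
proof -
  have "{n \<in> e ` A. x n \<notin> U} = e ` {a\<in>A. (x \<circ> e) a \<notin> U}" for U by auto
  then show ?thesis using assms unfolding converges_on_def by auto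
qed

lemma converges_on_enumerate:
  fixes x :: "nat \<Rightarrow> 'b"
  assumes "converges_on T x A l" "infinite A"
  shows "limitin T (x \<circ> enumerate A) l sequentially"
  unfolding limitin_def
proof (intro conjI allI impI)
  show "l \<in> topspace T" using assms by (simp add: converges_on_def)
  fix U assume "openin T U \<and> l \<in> U"
  then have fin: "finite {n\<in>A. x n \<notin> U}" using assms by (simp add: converges_on_def)
  have "inj (enumerate A)"
    using assms(2) by (simp add: strict_mono_enumerate strict_mono_imp_inj_on)
  then have "finite (enumerate A -` {n\<in>A. x n \<notin> U})" using fin finite_vimageI by blast
  then have "finite {k. (x \<circ> enumerate A) k \<notin> U}"
    by (rule rev_finite_subset) (use enumerate_in_set[OF assms(2)] in auto)
  then show "\<forall>\<^sub>F k in sequentially. (x \<circ> enumerate A) k \<in> U"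
    by (simp add: eventually_sequentially_iff_finite)
qed

text \<open>A sequence is read on \<open>X\<close> through an enumeration; a set outside
  \<open>I\<close> is infinite, so it yields a subsequence.\<close>

lemma FinBW_imp_seq_compact_space:
  assumes I: "is_ideal I X" and T: "FinBW T I X"
  shows "seq_compact_space T"
  unfolding seq_compact_space_def
proof (intro allI impI)
  fix x :: "nat \<Rightarrow> 'b" assume x: "range x \<subseteq> topspace T"
  define e where "e = to_nat_on X"
  have X: "countable X" "infinite X" using I by (auto simp: is_ideal_def)
  obtain A l where A: "A \<subseteq> X" "A \<notin> I" "converges_on T (x \<circ> e) A l"
    using T x unfolding FinBW_def by (metis comp_apply rangeI subsetD)
  have "infinite A" using ideal_finite[OF I A(1)] A(2) by blast
  then have "infinite (e ` A)"
    using A(1) X by (metis e_def finite_imageD inj_on_subset inj_on_to_nat_on)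
  then show "\<exists>r l. strict_mono r \<and> limitin T (x \<circ> r) l sequentially"
    using converges_on_enumerate[OF converges_on_image[OF A(3)]] strict_mono_enumerate by blast
qed

text \<open>One index is kept for each value; enumerating the kept indices gives a
  subsequence.\<close>

lemma injective_subsequence:
  assumes "limitin T x p sequentially" "infinite (range x)"
  obtains y :: "nat \<Rightarrow> 'b" where "inj y" "range y \<subseteq> range x" "limitin T y p sequentially"
proof -
  obtain E where E: "inj_on x E" "range x = x ` E"
    using subset_image_inj[of "range x" x UNIV] by auto
  then have inf: "infinite E" using assms(2) by auto
  have "inj (x \<circ> enumerate E)"
    using E(1) inf by (intro comp_inj_on) (auto simp: strict_mono_enumerate strict_mono_imp_inj_on range_enumerate)
  moreover have "limitin T (x \<circ> enumerate E) p sequentially"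
    using limitin_subsequence[OF strict_mono_enumerate[OF inf] assms(1)] .
  ultimately show thesis using that[of "x \<circ> enumerate E"] by auto
qed

text \<open>With disjoint neighbourhoods \<open>U\<close> and \<open>V\<close> of the limits, for
  all but finitely many \<open>n\<close> a common value lies in \<open>U\<close>, hence is one of
  the finitely many terms of \<open>y\<close> outside \<open>V\<close>, and \<open>x\<close> takes
  each value at most once.\<close>

lemma almost_disjoint_ranges:
  fixes x y :: "nat \<Rightarrow> 'b"
  assumes T: "Hausdorff_space T" and x: "limitin T x p sequentially" "inj x"
    and y: "limitin T y q sequentially" and "p \<noteq> q"
  shows "finite {n. x n \<in> range y}"
proof -
  have "p \<in> topspace T" "q \<in> topspace T" using x y by (auto simp: limitin_def)
  then obtain U V where UV: "openin T U" "openin T V" "p \<in> U" "q \<in> V" "disjnt U V"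
    using T \<open>p \<noteq> q\<close> unfolding Hausdorff_space_def by metis
  have "finite {n. x n \<notin> U}" "finite {n. y n \<notin> V}"
    using x(1) y UV by (auto simp: limitin_def eventually_sequentially_iff_finite)
  then have "finite ({n. x n \<notin> U} \<union> x -` (y ` {n. y n \<notin> V}))"
    using finite_vimageI[OF _ x(2)] by blast
  then show ?thesis by (rule rev_finite_subset) (use UV(5) in \<open>auto simp: disjnt_iff\<close>)
qed

lemma disjoint_convergent_sequences:
  fixes T :: "'b topology"
  assumes T: "Hausdorff_space T" "seq_compact_space T" "\<not> boring_space T"
  obtains w :: "nat \<Rightarrow> nat \<Rightarrow> 'b" and l where "inj l" "\<And>i. inj (w i)"
    "\<And>i. range (w i) \<subseteq> topspace T" "\<And>i. limitin T (w i) (l i) sequentially"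
    "\<And>i j. i \<noteq> j \<Longrightarrow> range (w i) \<inter> range (w j) = {}"
proof -
  \<comment> \<open>All limits of sequences with infinite range. Were \<open>L\<close> finite, it
    would itself be the finite set that makes \<open>T\<close> boring.\<close>
  define L where "L = {p. \<exists>x::nat \<Rightarrow> 'b. range x \<subseteq> topspace T \<and> infinite (range x)
    \<and> limitin T x p sequentially}"
  have "L \<subseteq> topspace T" by (auto simp: L_def limitin_def)
  then have "infinite L" using T(2,3) unfolding boring_space_def L_def by blast
  then obtain l :: "nat \<Rightarrow> 'b" where l: "inj l" "range l \<subseteq> L"
    using infinite_countable_subset by blast
  have "\<exists>y::nat \<Rightarrow> 'b. inj y \<and> range y \<subseteq> topspace T \<and> limitin T y (l i) sequentially" for i
  proof -
    have "l i \<in> L" using l by blast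
    then obtain x :: "nat \<Rightarrow> 'b" where x: "range x \<subseteq> topspace T" "infinite (range x)"
        "limitin T x (l i) sequentially"
      unfolding L_def by blast
    show ?thesis by (rule injective_subsequence[OF x(3,2)]) (use x(1) in blast)
  qed
  then obtain y :: "nat \<Rightarrow> nat \<Rightarrow> 'b" where y: "\<And>i. inj (y i)" "\<And>i. range (y i) \<subseteq> topspace T"
      "\<And>i. limitin T (y i) (l i) sequentially"
    by metis
  \<comment> \<open>As the limits differ, \<open>y i\<close> meets the ranges of the earlier
    sequences only finitely often; dropping these initial terms makes all ranges disjoint.\<close>
  have "\<exists>N. \<forall>n\<ge>N. \<forall>j<i. y i n \<notin> range (y j)" for i
  proof -
    have "finite {n. y i n \<in> range (y j)}" if "j < i" for j
      using almost_disjoint_ranges[OF T(1) y(3,1) y(3)] that l(1) by (simp add: inj_eq)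
    then have "finite (\<Union>j\<in>{..<i}. {n. y i n \<in> range (y j)})" by simp
    then obtain N where "\<forall>n\<in>(\<Union>j\<in>{..<i}. {n. y i n \<in> range (y j)}). n < N"
      using finite_nat_set_iff_bounded by blast
    then show ?thesis by (intro exI[of _ N]) (auto simp: not_le[symmetric])
  qed
  then obtain N where N: "\<And>i n j. n \<ge> N i \<Longrightarrow> j < i \<Longrightarrow> y i n \<notin> range (y j)" by metis
  define w where "w i n = y i (n + N i)" for i n
  have sub: "range (w i) \<subseteq> range (y i)" for i by (auto simp: w_def)
  have new: "w i n \<notin> range (w j)" if "j < i" for i j n
    using N[of i "n + N i" j] that sub[of j] by (auto simp: w_def)
  show thesis
  proof (rule that[of l w])
    show "inj (w i)" for i using injD[OF y(1)[of i]] by (fastforce simp: w_def intro: injI)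
    show "range (w i) \<subseteq> topspace T" for i using sub y(2) by blast
    show "limitin T (w i) (l i) sequentially" for i
    proof -
      have "strict_mono (\<lambda>n. n + N i)" by (simp add: strict_mono_def)
      moreover have "w i = y i \<circ> (\<lambda>n. n + N i)" by (auto simp: w_def)
      ultimately show ?thesis using limitin_subsequence[OF _ y(3), of "\<lambda>n. n + N i" i] by simp
    qed
    show "range (w i) \<inter> range (w j) = {}" if "i \<noteq> j" for i j
    proof (cases i j rule: linorder_cases)
      case less
      then show ?thesis using new[OF less] by (metis disjoint_iff rangeE)
    next
      case greater
      then show ?thesis using new[OF greater] by (metis disjoint_iff rangeE)
    qed (use that in simp)
  qed (use l in auto)
qed

text \<open>Here \<open>x (i, j, k) = w i j\<close>: each point is repeated infinitely often, so a positive set on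
  which \<open>x\<close> converges would force infinitely many of the disjoint sequences \<open>w i\<close> to contain the
  limit or to converge to it.\<close>

lemma boring_space_if_boring_ideal:
  fixes T :: "'b topology"
  assumes I: "is_ideal I X" and bor: "boring_ideal I X" and T: "FinBW T I X"
  shows "boring_space T"
proof (rule ccontr)
  assume nb: "\<not> boring_space T"
  have H: "Hausdorff_space T" using T by (simp add: FinBW_def)
  obtain w :: "nat \<Rightarrow> nat \<Rightarrow> 'b" and l where l: "inj l" and w: "\<And>i. inj (w i)"
    "\<And>i. range (w i) \<subseteq> topspace T" "\<And>i. limitin T (w i) (l i) sequentially"
    "\<And>i j. i \<noteq> j \<Longrightarrow> range (w i) \<inter> range (w j) = {}"
    by (rule disjoint_convergent_sequences[OF H FinBW_imp_seq_compact_space[OF I T] nb]) (rule that)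
  obtain f where f: "bij_betw f X (UNIV :: (nat \<times> nat \<times> nat) set)"
      and fI: "\<And>A. A \<in> BI \<Longrightarrow> f -` A \<inter> X \<in> I"
    using bor unfolding boring_ideal_def ideal_below_def by blast
  define x where "x = (\<lambda>(i, j, k::nat). w i j)"
  have "(x \<circ> f) n \<in> topspace T" for n using w(2) by (auto simp: x_def split: prod.split)
  then obtain A p where A: "A \<subseteq> X" "A \<notin> I" "converges_on T (x \<circ> f) A p"
    using T unfolding FinBW_def by blast
  define B where "B = f ` A"
  have conv: "converges_on T x B p" unfolding B_def using converges_on_image[OF A(3)] .
  \<comment> \<open>On an infinite column \<open>x\<close> takes the value \<open>w i j\<close>
    infinitely often; points are closed, so this value is the limit.\<close>
  have inf_j: "w i j = p" if inf: "infinite (sect (sect B i) j)" for i j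
  proof (rule ccontr)
    assume ne: "w i j \<noteq> p"
    have p: "p \<in> topspace T" using conv by (simp add: converges_on_def)
    have "w i j \<in> topspace T" using w(2) by blast
    then have "openin T (topspace T - {w i j})"
      using H by (simp add: Hausdorff_imp_t1_space closedin_t1_singleton openin_diff)
    then have "finite {b\<in>B. x b \<notin> topspace T - {w i j}}"
      using conv p ne unfolding converges_on_def by blast
    moreover have "(\<lambda>k. (i, j, k)) ` sect (sect B i) j \<subseteq> {b\<in>B. x b \<notin> topspace T - {w i j}}"
      by (auto simp: sect_def x_def)
    moreover have "inj_on (\<lambda>k. (i, j, k)) (sect (sect B i) j)" by (auto simp: inj_on_def)
    ultimately show False using inf inj_on_finite by blast
  qed
  have Fin2: "sect B i \<in> Fin2" for i
  proof -
    have "finite (w i -` {p})" using finite_vimageI[OF _ w(1)] by blast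
    then have "finite {j. infinite (sect (sect B i) j)}"
      by (rule rev_finite_subset) (use inf_j in auto)
    then show ?thesis by (simp add: Fin2_def)
  qed
  have inf_i: "l i = p \<or> p \<in> range (w i)" if inf: "infinite (sect B i)" for i
  proof (rule ccontr)
    assume ne: "\<not> (l i = p \<or> p \<in> range (w i))"
    then have fin: "finite (sect (sect B i) j)" for j using inf_j by blast
    \<comment> \<open>With all columns finite, an infinite layer meets infinitely many of them.
      Along these \<open>w i\<close> converges to \<open>p\<close>, which forces
      \<open>p = l i\<close>.\<close>
    define J where "J = {j. sect (sect B i) j \<noteq> {}}"
    have "infinite J"
    proof
      assume "finite J"
      then have "finite (SIGMA j:J. sect (sect B i) j)" using fin by blast
      moreover have "sect B i \<subseteq> (SIGMA j:J. sect (sect B i) j)"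
        by (auto simp: J_def sect_def)
      ultimately show False using inf finite_subset by blast
    qed
    have "converges_on T (w i) J p"
      unfolding converges_on_def
    proof (intro conjI allI impI)
      show "p \<in> topspace T" using conv by (simp add: converges_on_def)
      fix U assume "openin T U \<and> p \<in> U"
      then have "finite {b\<in>B. x b \<notin> U}" using conv by (simp add: converges_on_def)
      then have "finite ((\<lambda>(i, j, k). j) ` {b\<in>B. x b \<notin> U})" by blast
      then show "finite {j\<in>J. w i j \<notin> U}"
      proof (rule rev_finite_subset, intro subsetI)
        fix j assume j: "j \<in> {j\<in>J. w i j \<notin> U}"
        then obtain k where "(i, j, k) \<in> B" by (auto simp: J_def sect_def)
        then have "(i, j, k) \<in> {b\<in>B. x b \<notin> U}" using j by (simp add: x_def)
        then show "j \<in> (\<lambda>(i, j, k). j) ` {b\<in>B. x b \<notin> U}" by (rule rev_image_eqI) simp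
      qed
    qed
    then have "limitin T (w i \<circ> enumerate J) p sequentially"
      using \<open>infinite J\<close> by (rule converges_on_enumerate)
    moreover have "limitin T (w i \<circ> enumerate J) (l i) sequentially"
      using limitin_subsequence[OF strict_mono_enumerate[OF \<open>infinite J\<close>] w(3)] .
    ultimately have "p = l i" by (rule limitin_Hausdorff_unique[OF _ _ _ H]) simp
    then show False using ne by blast
  qed
  \<comment> \<open>\<open>l\<close> is injective and the ranges are disjoint, so each alternative
    in \<open>inf_i\<close> occurs for finitely many \<open>i\<close> only.\<close>
  have "finite {i. infinite (sect B i)}"
  proof -
    have "finite (l -` {p})" using finite_vimageI[OF _ l] by blast
    moreover have "finite {i. p \<in> range (w i)}"
    proof (cases "\<exists>i. p \<in> range (w i)")
      case True
      then obtain i0 where "p \<in> range (w i0)" by blast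
      then have "{i. p \<in> range (w i)} \<subseteq> {i0}" using w(4) by blast
      then show ?thesis using finite_subset by blast
    qed simp
    ultimately have "finite (l -` {p} \<union> {i. p \<in> range (w i)})" by blast
    then show ?thesis by (rule rev_finite_subset) (use inf_i in auto)
  qed
  then obtain k where "\<forall>i\<in>{i. infinite (sect B i)}. i < k"
    using finite_nat_set_iff_bounded by blast
  then have "B \<in> BI" using Fin2 unfolding BI_def by (auto simp: not_le[symmetric])
  then have "f -` B \<inter> X \<in> I" by (rule fI)
  then have "A \<in> I" by (rule ideal_subset[OF I]) (use A(1) in \<open>auto simp: B_def\<close>)
  then show False using A(2) by blast
qed

text \<open>Every point outside the finite set \<open>F\<close> belongs to the countable dense set
  \<open>D\<close>. Otherwise it has a neighbourhood disjoint from a neighbourhood of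
  \<open>F\<close>; the trace of \<open>D\<close> there is finite and can be removed, leaving a
  nonempty open set that misses \<open>D\<close>.\<close>

lemma countable_separable_boring_space:
  assumes H: "Hausdorff_space T" and bor: "boring_space T" and sep: "separable_space T"
  shows "countable (topspace T)"
proof -
  obtain D where D: "countable D" "D \<subseteq> topspace T" "T closure_of D = topspace T"
    using sep unfolding separable_space_def by blast
  have sc: "seq_compact_space T" using bor by (simp add: boring_space_def)
  obtain F where F: "finite F" "F \<subseteq> topspace T" and
    lim: "\<And>(x::nat \<Rightarrow> 'a) l. range x \<subseteq> topspace T \<Longrightarrow> infinite (range x) \<Longrightarrow>
      limitin T x l sequentially \<Longrightarrow> \<exists>l\<in>F. limitin T x l sequentially"
    by (rule boring_spaceE[OF bor]) (rule that)
  have "p \<in> D" if p: "p \<in> topspace T" "p \<notin> F" for p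
  proof (rule ccontr)
    assume "p \<notin> D"
    have "compactin T {p}" "compactin T F" "disjnt {p} F"
      using p F by (auto simp: finite_imp_compactin)
    then obtain U V where UV: "openin T U" "openin T V" "{p} \<subseteq> U" "F \<subseteq> V" "disjnt U V"
      by (rule Hausdorff_space_compact_separation[OF H])
    \<comment> \<open>An infinite trace would contain an injective convergent sequence. It also
      converges to a point of \<open>F\<close> and so enters \<open>V\<close>, which is disjoint
      from \<open>U\<close>.\<close>
    have "finite (U \<inter> D)"
    proof (rule ccontr)
      assume "infinite (U \<inter> D)"
      then obtain s :: "nat \<Rightarrow> 'a" where s: "inj s" "range s \<subseteq> U \<inter> D"
        using infinite_countable_subset by blast
      then have "range s \<subseteq> topspace T" using D(2) by blast
      then obtain r l where r: "strict_mono r" "limitin T (s \<circ> r) l sequentially"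
        using sc unfolding seq_compact_space_def by blast
      have "inj (s \<circ> r)" using s(1) r(1) by (simp add: inj_compose strict_mono_imp_inj_on)
      then have "infinite (range (s \<circ> r))" using range_inj_infinite by blast
      moreover have "range (s \<circ> r) \<subseteq> topspace T" using \<open>range s \<subseteq> topspace T\<close> by auto
      ultimately obtain q where "q \<in> F" "limitin T (s \<circ> r) q sequentially"
        using lim[OF _ _ r(2)] by blast
      then have "eventually (\<lambda>n. (s \<circ> r) n \<in> V) sequentially"
        using UV by (auto simp: limitin_def)
      then obtain n where "s (r n) \<in> V" by (auto simp: eventually_sequentially)
      then show False using s(2) UV(5) by (auto simp: disjnt_iff)
    qed
    then have "closedin T (U \<inter> D)"
      using Hausdorff_imp_t1_space[OF H] D(2) by (simp add: t1_space_closedin_finite le_infI2)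
    then have "openin T (U - U \<inter> D)" using UV(1) by blast
    moreover have "p \<in> U - U \<inter> D" using UV(3) \<open>p \<notin> D\<close> by blast
    moreover have "\<forall>S. p \<in> S \<and> openin T S \<longrightarrow> (\<exists>q. q \<in> D \<and> q \<in> S)"
      using p(1) D(3) in_closure_of[of p T D] by simp
    ultimately obtain q where "q \<in> D" "q \<in> U - U \<inter> D" by metis
    then show False by blast
  qed
  then have "topspace T \<subseteq> F \<union> D" by blast
  then show ?thesis using F(1) D(1) countable_subset by (metis countable_Un countable_finite)
qed

lemma unboring_ideal_if_uncountable_separable:
  assumes "is_ideal I X" "FinBW T I X" "separable_space T" "uncountable (topspace T)"
  shows "unboring_ideal I X"
proof (unfold unboring_ideal_def, rule notI)
  assume "boring_ideal I X"
  then have "boring_space T" using assms boring_space_if_boring_ideal by blast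
  then show False
    using assms countable_separable_boring_space unfolding FinBW_def by blast
qed

section \<open>Transfer along homeomorphisms\<close>

lemma converges_on_continuous_map:
  assumes f: "continuous_map T T' f" and x: "converges_on T x A l" "x ` A \<subseteq> topspace T"
  shows "converges_on T' (f \<circ> x) A (f l)"
  unfolding converges_on_def
proof (intro conjI allI impI)
  have l: "l \<in> topspace T" using x by (simp add: converges_on_def)
  then show "f l \<in> topspace T'" using f by (auto simp: continuous_map_def)
  fix U assume U: "openin T' U \<and> f l \<in> U"
  then have "openin T {y \<in> topspace T. f y \<in> U}" using f by (simp add: continuous_map_def)
  then have "finite {n\<in>A. x n \<notin> {y \<in> topspace T. f y \<in> U}}"
    using x(1) U l unfolding converges_on_def by blast
  then show "finite {n\<in>A. (f \<circ> x) n \<notin> U}" by (rule rev_finite_subset) auto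
qed

lemma FinBW_homeomorphic:
  assumes fg: "homeomorphic_maps T T' f g" and T: "FinBW T I X"
  shows "FinBW T' I X"
  unfolding FinBW_def
proof (intro conjI allI impI)
  show "Hausdorff_space T'"
    using T fg homeomorphic_Hausdorff_space unfolding FinBW_def homeomorphic_space_def by blast
  have f: "continuous_map T T' f" and g: "continuous_map T' T g"
    and fg_id: "\<And>y. y \<in> topspace T' \<Longrightarrow> f (g y) = y"
    using fg by (auto simp: homeomorphic_maps_def)
  fix x assume x: "\<forall>n\<in>X. x n \<in> topspace T'"
  then have gx: "\<forall>n\<in>X. (g \<circ> x) n \<in> topspace T" using g by (auto simp: continuous_map_def)
  then obtain A l where A: "A \<subseteq> X" "A \<notin> I" "converges_on T (g \<circ> x) A l"
    using T unfolding FinBW_def by blast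
  have "converges_on T' (f \<circ> (g \<circ> x)) A (f l)"
    using converges_on_continuous_map[OF f A(3)] gx A(1) by blast
  moreover have "{n\<in>A. (f \<circ> (g \<circ> x)) n \<notin> U} = {n\<in>A. x n \<notin> U}" for U
    using fg_id x A(1) by auto
  ultimately have "converges_on T' x A (f l)" unfolding converges_on_def by simp
  then show "\<exists>A\<subseteq>X. A \<notin> I \<and> (\<exists>l. converges_on T' x A l)" using A by blast
qed

lemma boring_space_homeomorphic:
  assumes fg: "homeomorphic_maps T T' f g" and bor: "boring_space T'"
  shows "boring_space T"
proof -
  have f: "continuous_map T T' f" and g: "continuous_map T' T g"
    and gf_id: "\<And>y. y \<in> topspace T \<Longrightarrow> g (f y) = y"
    using fg by (auto simp: homeomorphic_maps_def)
  have fx: "range (f \<circ> x) \<subseteq> topspace T'" if "range x \<subseteq> topspace T" for x :: "nat \<Rightarrow> _"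
    using that f by (auto simp: continuous_map_def)
  have gfx: "g \<circ> (f \<circ> x) = x" if "range x \<subseteq> topspace T" for x :: "nat \<Rightarrow> _"
    using that gf_id by (simp add: fun_eq_iff image_subset_iff)
  have sc: "seq_compact_space T'" using bor by (simp add: boring_space_def)
  obtain F where F: "finite F" "F \<subseteq> topspace T'" and
    lim: "\<And>(x::nat \<Rightarrow> _) l. range x \<subseteq> topspace T' \<Longrightarrow> infinite (range x) \<Longrightarrow>
      limitin T' x l sequentially \<Longrightarrow> \<exists>l\<in>F. limitin T' x l sequentially"
    by (rule boring_spaceE[OF bor]) (rule that)
  show ?thesis
    unfolding boring_space_def
  proof (intro conjI exI allI impI)
    show "seq_compact_space T"
      unfolding seq_compact_space_def
    proof (intro allI impI)
      fix x :: "nat \<Rightarrow> 'a" assume x: "range x \<subseteq> topspace T"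
      obtain r l where r: "strict_mono r" "limitin T' ((f \<circ> x) \<circ> r) l sequentially"
        using sc fx[OF x] unfolding seq_compact_space_def by blast
      have "limitin T (g \<circ> ((f \<circ> x) \<circ> r)) (g l) sequentially"
        using continuous_map_limit[OF g r(2)] .
      moreover have "g \<circ> ((f \<circ> x) \<circ> r) = x \<circ> r" using gfx[OF x] by (metis comp_assoc)
      ultimately show "\<exists>r l. strict_mono r \<and> limitin T (x \<circ> r) l sequentially"
        using r(1) by metis
    qed
    show "finite (g ` F)" using F(1) by blast
    show "g ` F \<subseteq> topspace T" using F(2) g by (auto simp: continuous_map_def)
    fix x :: "nat \<Rightarrow> 'a"
    assume *: "range x \<subseteq> topspace T \<and> infinite (range x) \<and> (\<exists>l. limitin T x l sequentially)"
    then have x: "range x \<subseteq> topspace T" by blast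
    have "infinite (range (f \<circ> x))"
      using * gfx[OF x] by (metis finite_imageI image_comp)
    moreover obtain l0 where "limitin T x l0 sequentially" using * by blast
    then have "limitin T' (f \<circ> x) (f l0) sequentially" using continuous_map_limit[OF f] by blast
    ultimately obtain l where "l \<in> F" "limitin T' (f \<circ> x) l sequentially"
      using lim[OF fx[OF x]] by blast
    then show "\<exists>l\<in>g ` F. limitin T x l sequentially"
      using continuous_map_limit[OF g] gfx[OF x] by (metis imageI)
  qed
qed

text \<open>Any injection between types carries a topology to a homeomorphic copy on the target
  type; this later moves Mrowka spaces to \<open>nat set\<close>.\<close>

lemma homeomorphic_maps_pullback_topology:
  assumes "inj j"
  shows "homeomorphic_maps T (pullback_topology (range j) (inv j) T) j (inv j)"
  unfolding homeomorphic_maps_def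
proof (intro conjI)
  show "continuous_map T (pullback_topology (range j) (inv j) T) j"
    using assms by (intro continuous_map_pullback') (auto simp: o_def)
  show "continuous_map (pullback_topology (range j) (inv j) T) T (inv j)"
    using continuous_map_pullback[of T T id "range j" "inv j"] by simp
qed (use assms in \<open>auto simp: topspace_pullback_topology\<close>)

section \<open>Mrowka spaces\<close>

lemma topspace_mrowka: "topspace (mrowka \<A>) = range PtN \<union> PtA ` \<A> \<union> {PtInf}"
proof
  show "topspace (mrowka \<A>) \<subseteq> range PtN \<union> PtA ` \<A> \<union> {PtInf}"
    unfolding mrowka_def topology_generated_by_topspace by auto
  have "PtN n \<in> topspace (mrowka \<A>)" for n
    unfolding mrowka_def topology_generated_by_topspace by blast
  moreover have "PtA A \<in> topspace (mrowka \<A>)" if "A \<in> \<A>" for A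
    unfolding mrowka_def topology_generated_by_topspace using that by blast
  moreover have "PtInf \<in> topspace (mrowka \<A>)"
    unfolding mrowka_def topology_generated_by_topspace by blast
  ultimately show "range PtN \<union> PtA ` \<A> \<union> {PtInf} \<subseteq> topspace (mrowka \<A>)" by blast
qed

lemma openin_mrowka_PtN: "openin (mrowka \<A>) {PtN n}"
  unfolding mrowka_def by (rule topology_generated_by_Basis) blast

lemma openin_mrowka_PtA:
  "A \<in> \<A> \<Longrightarrow> finite F \<Longrightarrow> openin (mrowka \<A>) (insert (PtA A) (PtN ` (A - F)))"
  unfolding mrowka_def by (rule topology_generated_by_Basis) blast

lemma openin_mrowka_PtInf:
  "finite F \<Longrightarrow> finite G \<Longrightarrow> G \<subseteq> \<A> \<Longrightarrow>
    openin (mrowka \<A>) (insert PtInf (PtA ` (\<A> - G) \<union> PtN ` (UNIV - (F \<union> \<Union>G))))"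
  unfolding mrowka_def by (rule topology_generated_by_Basis) blast

text \<open>\<open>mrowka\<close> is given by generators; induction over the generated topology
  recovers the intended neighbourhoods of \<open>PtA A\<close> and \<open>PtInf\<close>. Almost
  disjointness enters when a generator around \<open>PtInf\<close> contains \<open>PtA A\<close>:
  then \<open>A\<close> is not in \<open>G\<close> and loses only finitely many points to
  \<open>\<Union>G\<close>.\<close>

lemma openin_mrowka_nbhd:
  assumes AD: "AD_family \<A>" and "openin (mrowka \<A>) U"
  shows "(\<forall>A\<in>\<A>. PtA A \<in> U \<longrightarrow> finite {n\<in>A. PtN n \<notin> U}) \<and>
    (PtInf \<in> U \<longrightarrow> (\<exists>F G. finite F \<and> finite G \<and> G \<subseteq> \<A> \<and>
       PtA ` (\<A> - G) \<union> PtN ` (UNIV - (F \<union> \<Union>G)) \<subseteq> U))"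
proof -
  have "generate_topology_on ((\<lambda>n. {PtN n}) ` UNIV
      \<union> {insert (PtA A) (PtN ` (A - F)) | A F. A \<in> \<A> \<and> finite F}
      \<union> {insert PtInf (PtA ` (\<A> - G) \<union> PtN ` (UNIV - (F \<union> \<Union>G)))
          | F G. finite F \<and> finite G \<and> G \<subseteq> \<A>}) U"
    using assms(2) by (simp add: mrowka_def openin_topology_generated_by_iff)
  then show ?thesis
  proof (induction rule: generate_topology_on.induct)
    case Empty
    then show ?case by simp
  next
    case (Int U V)
    have "finite {n\<in>A. PtN n \<notin> U \<inter> V}" if "A \<in> \<A>" "PtA A \<in> U \<inter> V" for A
    proof -
      have "finite ({n\<in>A. PtN n \<notin> U} \<union> {n\<in>A. PtN n \<notin> V})" using Int.IH that by auto
      then show ?thesis by (rule rev_finite_subset) auto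
    qed
    moreover have "\<exists>F G. finite F \<and> finite G \<and> G \<subseteq> \<A> \<and>
       PtA ` (\<A> - G) \<union> PtN ` (UNIV - (F \<union> \<Union>G)) \<subseteq> U \<inter> V" if inf: "PtInf \<in> U \<inter> V"
    proof -
      obtain F G where 1: "finite F" "finite G" "G \<subseteq> \<A>"
          "PtA ` (\<A> - G) \<union> PtN ` (UNIV - (F \<union> \<Union>G)) \<subseteq> U"
        using Int.IH(1) inf by auto
      obtain F' G' where 2: "finite F'" "finite G'" "G' \<subseteq> \<A>"
          "PtA ` (\<A> - G') \<union> PtN ` (UNIV - (F' \<union> \<Union>G')) \<subseteq> V"
        using Int.IH(2) inf by auto
      have "PtA ` (\<A> - (G \<union> G')) \<union> PtN ` (UNIV - ((F \<union> F') \<union> \<Union>(G \<union> G'))) \<subseteq> U \<inter> V"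
        using 1(4) 2(4) by auto
      then show ?thesis
        using 1(1-3) 2(1-3) by (metis finite_Un le_sup_iff)
    qed
    ultimately show ?case by blast
  next
    case (UN K)
    have "finite {n\<in>A. PtN n \<notin> \<Union>K}" if "A \<in> \<A>" "PtA A \<in> \<Union>K" for A
    proof -
      obtain U where U: "U \<in> K" "PtA A \<in> U" using \<open>PtA A \<in> \<Union>K\<close> by blast
      then have "finite {n\<in>A. PtN n \<notin> U}" using UN.IH that(1) by blast
      then show ?thesis by (rule rev_finite_subset) (use U in auto)
    qed
    moreover have "\<exists>F G. finite F \<and> finite G \<and> G \<subseteq> \<A> \<and>
       PtA ` (\<A> - G) \<union> PtN ` (UNIV - (F \<union> \<Union>G)) \<subseteq> \<Union>K" if inf: "PtInf \<in> \<Union>K"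
    proof -
      obtain U where U: "U \<in> K" "PtInf \<in> U" using inf by blast
      then obtain F G where "finite F" "finite G" "G \<subseteq> \<A>"
          "PtA ` (\<A> - G) \<union> PtN ` (UNIV - (F \<union> \<Union>G)) \<subseteq> U"
        using UN.IH by meson
      then show ?thesis using U(1) by (meson Union_upper order_trans)
    qed
    ultimately show ?case by blast
  next
    case (Basis U)
    then consider n where "U = {PtN n}"
      | A F where "A \<in> \<A>" "finite F" "U = insert (PtA A) (PtN ` (A - F))"
      | F G where "finite F" "finite G" "G \<subseteq> \<A>"
          "U = insert PtInf (PtA ` (\<A> - G) \<union> PtN ` (UNIV - (F \<union> \<Union>G)))"
      by (elim UnE imageE CollectE exE conjE) simp_all
    then show ?case
    proof cases
      case 1
      then show ?thesis by simp
    next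
      case (2 A F)
      have "finite {n\<in>A. PtN n \<notin> U}"
        by (rule finite_subset[OF _ 2(2)]) (use 2 in auto)
      then show ?thesis using 2 by auto
    next
      case (3 F G)
      have "finite {n\<in>A. PtN n \<notin> U}" if "A \<in> \<A>" "PtA A \<in> U" for A
      proof -
        have "A \<notin> G" using 3 that by auto
        then have "finite (A \<inter> B)" if "B \<in> G" for B
          using AD 3(3) \<open>A \<in> \<A>\<close> that unfolding AD_family_def by (metis subsetD)
        then have "finite (\<Union>B\<in>G. A \<inter> B)" using 3(2) by (rule finite_UN_I[rotated])
        then have "finite (F \<union> (\<Union>B\<in>G. A \<inter> B))" using 3(1) by simp
        then show ?thesis by (rule rev_finite_subset) (use 3 in auto)
      qed
      moreover have "PtA ` (\<A> - G) \<union> PtN ` (UNIV - (F \<union> \<Union>G)) \<subseteq> U" using 3(4) by blast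
      ultimately show ?thesis using 3(1-3) by blast
    qed
  qed
qed

lemma openin_mrowka_finite_Diff:
  "AD_family \<A> \<Longrightarrow> openin (mrowka \<A>) U \<Longrightarrow> A \<in> \<A> \<Longrightarrow> PtA A \<in> U \<Longrightarrow> finite {n\<in>A. PtN n \<notin> U}"
  using openin_mrowka_nbhd by simp

lemma openin_mrowka_PtInfE:
  assumes "AD_family \<A>" "openin (mrowka \<A>) U" "PtInf \<in> U"
  obtains F G where "finite F" "finite G" "G \<subseteq> \<A>" "PtA ` (\<A> - G) \<subseteq> U"
    "PtN ` (UNIV - (F \<union> \<Union>G)) \<subseteq> U"
  using openin_mrowka_nbhd[OF assms(1,2)] assms(3) by auto

lemma Hausdorff_space_mrowka:
  assumes AD: "AD_family \<A>"
  shows "Hausdorff_space (mrowka \<A>)"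
proof -
  define sep where "sep p q \<longleftrightarrow>
    (\<exists>U V. openin (mrowka \<A>) U \<and> openin (mrowka \<A>) V \<and> p \<in> U \<and> q \<in> V \<and> disjnt U V)" for p q
  have sepI: "sep p q"
    if "openin (mrowka \<A>) U" "openin (mrowka \<A>) V" "p \<in> U" "q \<in> V" "U \<inter> V = {}" for p q U V
    using that unfolding sep_def disjnt_def by blast
  have sym: "sep q p" if "sep p q" for p q
    using that unfolding sep_def by (metis disjnt_sym)
  have nn: "sep (PtN n) (PtN m)" if "n \<noteq> m" for n m
    by (rule sepI[OF openin_mrowka_PtN[of _ n] openin_mrowka_PtN[of _ m]]) (use that in auto)
  have na: "sep (PtN n) (PtA A)" if "A \<in> \<A>" for n A
    by (rule sepI[OF openin_mrowka_PtN openin_mrowka_PtA[OF that, of "{n}"]]) auto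
  have ni: "sep (PtN n) PtInf" for n
    by (rule sepI[OF openin_mrowka_PtN openin_mrowka_PtInf[of "{n}" "{}"]]) auto
  \<comment> \<open>Removing the finite set \<open>A \<inter> B\<close> from one side separates two
    members; below, a member is separated from \<open>PtInf\<close> by putting it into
    \<open>G\<close>.\<close>
  have aa: "sep (PtA A) (PtA B)" if "A \<in> \<A>" "B \<in> \<A>" "A \<noteq> B" for A B
    by (rule sepI[OF openin_mrowka_PtA[OF that(1), of "{}"] openin_mrowka_PtA[OF that(2), of "A \<inter> B"]])
      (use that AD in \<open>auto simp: AD_family_def\<close>)
  have ai: "sep (PtA A) PtInf" if "A \<in> \<A>" for A
    by (rule sepI[OF openin_mrowka_PtA[OF that, of "{}"] openin_mrowka_PtInf[of "{}" "{A}"]])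
      (use that in auto)
  have "sep p q" if pq: "p \<in> topspace (mrowka \<A>)" "q \<in> topspace (mrowka \<A>)" "p \<noteq> q" for p q
  proof (cases p)
    case (PtN n)
    then show ?thesis using pq nn na ni by (cases q) (auto simp: topspace_mrowka)
  next
    case (PtA A)
    then have "A \<in> \<A>" using pq by (auto simp: topspace_mrowka)
    then show ?thesis using PtA pq aa[of A] na[THEN sym] ai
      by (cases q) (simp_all add: topspace_mrowka image_iff)
  next
    case PtInf
    then show ?thesis using pq ni[THEN sym] ai[THEN sym] by (cases q) (auto simp: topspace_mrowka)
  qed
  then show ?thesis unfolding Hausdorff_space_def sep_def by blast
qed

text \<open>The points \<open>PtN n\<close> are dense: a neighbourhood of \<open>PtA A\<close>
  contains almost all of the infinite set \<open>A\<close>, and a neighbourhood of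
  \<open>PtInf\<close> contains some \<open>PtA A\<close> because the family is infinite.\<close>

lemma separable_space_mrowka: "AD_family \<A> \<Longrightarrow> infinite \<A> \<Longrightarrow> separable_space (mrowka \<A>)"
  unfolding separable_space_def
proof (intro exI conjI)
  assume AD: "AD_family \<A>" and inf: "infinite \<A>"
  show "countable (range PtN)" by simp
  show "range PtN \<subseteq> topspace (mrowka \<A>)" by (auto simp: topspace_mrowka)
  have "\<exists>n. PtN n \<in> U" if U: "openin (mrowka \<A>) U" "p \<in> U" for p U
  proof -
    have hit: "\<exists>n. PtN n \<in> U" if "A \<in> \<A>" "PtA A \<in> U" for A
    proof (rule ccontr)
      assume "\<not> ?thesis"
      then have "{n\<in>A. PtN n \<notin> U} = A" by auto
      then show False
        using openin_mrowka_finite_Diff[OF AD U(1) that] AD that(1) by (simp add: AD_family_def)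
    qed
    have "p \<in> topspace (mrowka \<A>)" using U openin_subset by blast
    then consider n where "p = PtN n" | A where "A \<in> \<A>" "p = PtA A" | "p = PtInf"
      unfolding topspace_mrowka by blast
    then show ?thesis
    proof cases
      case 3
      then obtain F G where "finite G" "PtA ` (\<A> - G) \<subseteq> U"
        using openin_mrowka_PtInfE[OF AD U(1)] U(2) by metis
      moreover from this obtain A where "A \<in> \<A> - G"
        using inf by (metis all_not_in_conv finite_Diff2 finite.emptyI)
      ultimately show ?thesis using hit by blast
    qed (use U hit in auto)
  qed
  then show "mrowka \<A> closure_of range PtN = topspace (mrowka \<A>)"
    by (auto simp: closure_of_def)
qed

section \<open>Convergence and selection in Mrowka spaces\<close>

lemma converges_on_mrowka_PtA:
  assumes "AD_family \<A>" "A \<in> \<A>" "fin_to_one g E" "g ` E \<subseteq> PtN ` A"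
  shows "converges_on (mrowka \<A>) g E (PtA A)"
  unfolding converges_on_def
proof (intro conjI allI impI)
  show "PtA A \<in> topspace (mrowka \<A>)" using assms by (auto simp: topspace_mrowka)
  fix U assume "openin (mrowka \<A>) U \<and> PtA A \<in> U"
  then have "finite (PtN ` {n\<in>A. PtN n \<notin> U})" 
    using openin_mrowka_finite_Diff[OF assms(1) _ assms(2)] by simp
  then have "finite {x\<in>E. g x \<in> PtN ` {n\<in>A. PtN n \<notin> U}}"
    using fin_to_one_finite_preimage assms(3) by blast
  then show "finite {x\<in>E. g x \<notin> U}" by (rule rev_finite_subset) (use assms(4) in auto)
qed

text \<open>The complement of a neighbourhood of \<open>PtInf\<close> is covered by finitely many
  points and finitely many members of the family. The points have finite preimage because
  \<open>g\<close> is finite-to-one, the members by assumption \<open>A\<close>.\<close>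

lemma converges_on_mrowka_PtInf:
  assumes AD: "AD_family \<A>" and g: "fin_to_one g E" "g ` E \<subseteq> topspace (mrowka \<A>)"
    and A: "\<And>A. A \<in> \<A> \<Longrightarrow> finite {x\<in>E. g x \<in> PtN ` A}"
  shows "converges_on (mrowka \<A>) g E PtInf"
  unfolding converges_on_def
proof (intro conjI allI impI)
  show "PtInf \<in> topspace (mrowka \<A>)" by (auto simp: topspace_mrowka)
  fix U assume U: "openin (mrowka \<A>) U \<and> PtInf \<in> U"
  then obtain F G where FG: "finite F" "finite G" "G \<subseteq> \<A>"
      "PtA ` (\<A> - G) \<subseteq> U" "PtN ` (UNIV - (F \<union> \<Union>G)) \<subseteq> U"
    using openin_mrowka_PtInfE[OF AD, of U] by metis
  have "finite {x\<in>E. g x \<in> PtN ` F \<union> PtA ` G}"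
    using g(1) FG by (intro fin_to_one_finite_preimage) auto
  moreover have "finite (\<Union>A\<in>G. {x\<in>E. g x \<in> PtN ` A})" using FG A by auto
  ultimately have "finite ({x\<in>E. g x \<in> PtN ` F \<union> PtA ` G} \<union> (\<Union>A\<in>G. {x\<in>E. g x \<in> PtN ` A}))"
    by simp
  then show "finite {x\<in>E. g x \<notin> U}"
  proof (rule rev_finite_subset, intro subsetI)
    fix x assume x: "x \<in> {x\<in>E. g x \<notin> U}"
    then have "g x \<in> topspace (mrowka \<A>)" using g(2) by auto
    then show "x \<in> {x\<in>E. g x \<in> PtN ` F \<union> PtA ` G} \<union> (\<Union>A\<in>G. {x\<in>E. g x \<in> PtN ` A})"
      unfolding topspace_mrowka
    proof (elim UnE imageE)
      fix A assume A: "g x = PtA A" "A \<in> \<A>"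
      then have "A \<in> G" using x FG(4) by auto
      then show ?thesis using x A by auto
    next
      fix n assume n: "g x = PtN n"
      then have "n \<in> F \<union> \<Union>G" using x FG(5) by auto
      then show ?thesis using x n by auto
    qed (use x U in auto)
  qed
qed

text \<open>If \<open>g\<close> converges on no positive set, it satisfies the premises of
  \<open>sel\<close>: on a fibre it converges as a constant, finite-to-one parts off the natural
  points converge to \<open>PtInf\<close>, and those inside \<open>A\<close> to
  \<open>PtA A\<close>. On the set given by \<open>sel\<close> it then converges to
  \<open>PtInf\<close> after all.\<close>

lemma FinBW_mrowkaI:
  assumes I: "is_ideal I X" and AD: "AD_family \<A>"
    and sel: "\<And>g. \<lbrakk>\<And>v. {x\<in>X. g x = v} \<in> I;
        \<And>E. \<lbrakk>E \<subseteq> X; g ` E \<subseteq> - range PtN; fin_to_one g E\<rbrakk> \<Longrightarrow> E \<in> I;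
        \<And>A E. \<lbrakk>A \<in> \<A>; E \<subseteq> X; g ` E \<subseteq> PtN ` A; fin_to_one g E\<rbrakk> \<Longrightarrow> E \<in> I\<rbrakk>
      \<Longrightarrow> \<exists>E\<subseteq>X. E \<notin> I \<and> fin_to_one g E \<and> (\<forall>A\<in>\<A>. finite {x\<in>E. g x \<in> PtN ` A})"
  shows "FinBW (mrowka \<A>) I X"
  unfolding FinBW_def
proof (intro conjI allI impI)
  show "Hausdorff_space (mrowka \<A>)" using Hausdorff_space_mrowka AD by blast
  fix g :: "'a \<Rightarrow> phi_point"
  assume g: "\<forall>n\<in>X. g n \<in> topspace (mrowka \<A>)"
  show "\<exists>E\<subseteq>X. E \<notin> I \<and> (\<exists>l. converges_on (mrowka \<A>) g E l)"
  proof (rule ccontr)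
    assume "\<not> ?thesis"
    then have div: "E \<in> I" if "converges_on (mrowka \<A>) g E l" "E \<subseteq> X" for E l using that by blast
    have "{x\<in>X. g x = v} \<in> I" for v
    proof (cases "v \<in> topspace (mrowka \<A>)")
      case True
      have "{n \<in> {x\<in>X. g x = v}. g n \<notin> U} = {}" if "v \<in> U" for U using that by auto
      then have "converges_on (mrowka \<A>) g {x\<in>X. g x = v} v"
        using True unfolding converges_on_def by (metis (no_types, lifting) finite.emptyI)
      then show ?thesis by (rule div) auto
    next
      case False
      then have "{x\<in>X. g x = v} = {}" using g by auto
      then show ?thesis using ideal_finite[OF I, of "{}"] by (simp only:) simp
    qed
    moreover have "E \<in> I" if E: "E \<subseteq> X" "g ` E \<subseteq> - range PtN" "fin_to_one g E" for E
    proof -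
      have "{x\<in>E. g x \<in> PtN ` A} = {}" for A using E(2) by auto
      then have "finite {x\<in>E. g x \<in> PtN ` A}" for A by (simp only: finite.emptyI)
      then show ?thesis
        using converges_on_mrowka_PtInf[OF AD E(3)] div E(1) g by blast
    qed
    moreover have "E \<in> I" if "A \<in> \<A>" "E \<subseteq> X" "g ` E \<subseteq> PtN ` A" "fin_to_one g E" for A E
      using converges_on_mrowka_PtA[OF AD] that div by blast
    ultimately obtain E where E: "E \<subseteq> X" "E \<notin> I" "fin_to_one g E"
        "\<And>A. A \<in> \<A> \<Longrightarrow> finite {x\<in>E. g x \<in> PtN ` A}"
      using sel[of g] by blast
    then show False using converges_on_mrowka_PtInf[OF AD E(3)] div g by blast
  qed
qed

text \<open>An instance of \<open>unboring_ideal_selection\<close> in which the complement of the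
  natural points is one of the avoided sets. The selected set meets its preimage finitely, so that
  part can be deleted and positivity is kept.\<close>

lemma unboring_ideal_mrowka_selection:
  fixes g :: "'a \<Rightarrow> phi_point"
  assumes I: "is_ideal I X" and unb: "unboring_ideal I X" and \<C>: "countable \<C>"
    and fib: "\<And>v. {x\<in>X. g x = v} \<in> I"
    and N: "\<And>E. \<lbrakk>E \<subseteq> X; g ` E \<subseteq> - range PtN; fin_to_one g E\<rbrakk> \<Longrightarrow> E \<in> I"
    and A: "\<And>A E. \<lbrakk>A \<in> \<C>; E \<subseteq> X; g ` E \<subseteq> PtN ` A; fin_to_one g E\<rbrakk> \<Longrightarrow> E \<in> I"
  shows "\<exists>E\<subseteq>X. E \<notin> I \<and> fin_to_one g E \<and> g ` E \<subseteq> range PtN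
    \<and> (\<forall>A\<in>\<C>. finite {x\<in>E. g x \<in> PtN ` A})"
proof -
  \<comment> \<open>The inserted set also keeps \<open>\<P>\<close> nonempty, so that
    \<open>from_nat_into\<close> enumerates exactly \<open>\<P>\<close>.\<close>
  define \<P> where "\<P> = insert (- range PtN) ((`) PtN ` \<C>)"
  have "countable \<P>" "\<P> \<noteq> {}" using \<C> by (auto simp: \<P>_def)
  then have P: "range (from_nat_into \<P>) = \<P>" by simp
  have P': "E \<in> I" if "E \<subseteq> X" "g ` E \<subseteq> from_nat_into \<P> n" "fin_to_one g E" for n E
  proof -
    have "from_nat_into \<P> n \<in> \<P>" using P by blast
    then show ?thesis using that N A unfolding \<P>_def by auto
  qed
  show ?thesis
  proof (rule unboring_ideal_selection[where P = "from_nat_into \<P>", OF I unb fib P'])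
    fix E assume E: "E \<subseteq> X" "E \<notin> I" "fin_to_one g E"
      and E': "\<And>n. finite {x\<in>E. g x \<in> from_nat_into \<P> n}"
    have fin: "finite {x\<in>E. g x \<in> Q}" if "Q \<in> \<P>" for Q
      using from_nat_into_surj[OF \<open>countable \<P>\<close> that] E' by auto
    have finN: "finite {x\<in>E. g x \<in> - range PtN}" by (rule fin) (simp add: \<P>_def)
    define D where "D = E - {x\<in>E. g x \<in> - range PtN}"
    show ?thesis
    proof (intro exI conjI ballI)
      show "D \<subseteq> X" using E(1) by (auto simp: D_def)
      show "D \<notin> I" unfolding D_def
        by (rule ideal_Diff_finite[OF I E(2)]) (use E(1) finN in auto)
      show "fin_to_one g D" by (rule fin_to_one_subset[OF E(3)]) (auto simp: D_def)
      show "g ` D \<subseteq> range PtN" by (auto simp: D_def)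
      show "finite {x\<in>D. g x \<in> PtN ` A}" if "A \<in> \<C>" for A
        by (rule finite_subset[OF _ fin[of "PtN ` A"]]) (use that in \<open>auto simp: \<P>_def D_def\<close>)
    qed
  qed
qed

lemma FinBW_mrowka_countable:
  assumes "is_ideal I X" "unboring_ideal I X" "AD_family \<A>" "countable \<A>"
  shows "FinBW (mrowka \<A>) I X"
proof (rule FinBW_mrowkaI[OF assms(1,3)], goal_cases)
  case (1 g)
  have "\<exists>E\<subseteq>X. E \<notin> I \<and> fin_to_one g E \<and> g ` E \<subseteq> range PtN
    \<and> (\<forall>A\<in>\<A>. finite {x\<in>E. g x \<in> PtN ` A})"
    using 1 by (rule unboring_ideal_mrowka_selection[OF assms(1,2,4)])
  then show ?case by blast
qed

text \<open>The increasing enumeration of \<open>A\<close> converges to \<open>PtA A\<close> and to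
  nothing else, so a finite set of limits would have to contain \<open>PtA A\<close> for infinitely
  many \<open>A\<close>.\<close>

lemma not_boring_space_mrowka:
  assumes AD: "AD_family \<A>" and inf: "infinite \<A>"
  shows "\<not> boring_space (mrowka \<A>)"
proof
  assume "boring_space (mrowka \<A>)"
  then obtain F where F: "finite F" and
    lim: "\<And>(x::nat \<Rightarrow> phi_point) l. range x \<subseteq> topspace (mrowka \<A>) \<Longrightarrow> infinite (range x) \<Longrightarrow>
      limitin (mrowka \<A>) x l sequentially \<Longrightarrow> \<exists>l\<in>F. limitin (mrowka \<A>) x l sequentially"
    by (rule boring_spaceE) (rule that)
  have "PtA A \<in> F" if A: "A \<in> \<A>" for A
  proof -
    have infA: "infinite A" using AD A by (auto simp: AD_family_def)
    have inj: "inj_on PtN A" by (simp add: inj_on_def)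
    have "converges_on (mrowka \<A>) PtN A (PtA A)"
      using converges_on_mrowka_PtA[OF AD A fin_to_one_inj_on[OF inj]] by simp
    then have conv: "limitin (mrowka \<A>) (PtN \<circ> enumerate A) (PtA A) sequentially"
      using infA by (rule converges_on_enumerate)
    have ran: "range (PtN \<circ> enumerate A) = PtN ` A"
      using range_enumerate[OF infA] by (metis image_comp)
    have "PtN ` A \<subseteq> topspace (mrowka \<A>)" by (auto simp: topspace_mrowka)
    moreover have "infinite (PtN ` A)" using infA inj by (simp add: finite_image_iff)
    ultimately obtain l where "l \<in> F" "limitin (mrowka \<A>) (PtN \<circ> enumerate A) l sequentially"
      using lim[OF _ _ conv] ran by auto
    then show ?thesis
      using limitin_Hausdorff_unique[OF conv _ _ Hausdorff_space_mrowka[OF AD]] by simp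
  qed
  then have "PtA ` \<A> \<subseteq> F" by blast
  moreover have "inj_on PtA \<A>" by (simp add: inj_on_def)
  ultimately show False using F inf by (meson inj_on_finite)
qed

section \<open>Uncountable families under CH\<close>

lemma lepoll_nat_option_reals: "(UNIV :: (nat \<Rightarrow> nat option) set) \<lesssim> (UNIV :: real set)"
proof -
  define h where "h y = prod_encode ` {(n, k). y n = Some k}" for y :: "nat \<Rightarrow> nat option"
  have "inj h"
  proof (rule injI)
    fix y z :: "nat \<Rightarrow> nat option"
    assume "h y = h z"
    then have "{(n, k). y n = Some k} = {(n, k). z n = Some k}"
      unfolding h_def by (simp add: inj_image_eq_iff inj_prod_encode)
    then have "y n = Some k \<longleftrightarrow> z n = Some k" for n k by blast
    then show "y = z" by (metis not_None_eq ext)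
  qed
  then have "(UNIV :: (nat \<Rightarrow> nat option) set) \<lesssim> (UNIV :: nat set set)"
    unfolding lepoll_def by blast
  then show ?thesis using nat_sets_eqpoll_reals lepoll_trans2 by blast
qed

lemma uncountable_nat_option: "uncountable (UNIV :: (nat \<Rightarrow> nat option) set)"
proof
  assume "countable (UNIV :: (nat \<Rightarrow> nat option) set)"
  moreover have "inj (\<lambda>(A::nat set) n. if n \<in> A then Some (0::nat) else None)"
  proof (rule injI, rule set_eqI)
    fix A B :: "nat set" and n
    assume eq: "(\<lambda>n. if n \<in> A then Some (0::nat) else None) = (\<lambda>n. if n \<in> B then Some 0 else None)"
    show "n \<in> A \<longleftrightarrow> n \<in> B" using fun_cong[OF eq, of n] by (auto split: if_splits)
  qed
  ultimately have "countable (UNIV :: nat set set)"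
    using countable_image_inj_on countable_subset subset_UNIV by metis
  then show False
    using nat_sets_eqpoll_reals uncountable_UNIV_real countable_lepoll eqpoll_imp_lepoll eqpoll_sym
    by metis
qed

text \<open>In a well-order of least type on the partial functions, initial segments are strictly
  smaller than the whole. An uncountable one, embedded in the reals, would by \<open>CH\<close> have
  the size of the continuum and hence of the whole.\<close>

lemma CH_wellorder:
  assumes CH
  obtains r :: "((nat \<Rightarrow> nat option) \<times> (nat \<Rightarrow> nat option)) set" where "wf r"
    "\<And>y z. y \<noteq> z \<Longrightarrow> (y, z) \<in> r \<or> (z, y) \<in> r" "\<And>y. countable {z. (z, y) \<in> r}"
proof -
  define r0 :: "((nat \<Rightarrow> nat option) \<times> (nat \<Rightarrow> nat option)) set" where "r0 = card_of UNIV"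
  have W: "well_order_on UNIV r0" by (simp add: r0_def card_of_well_order_on)
  have card: "Card_order r0" by (simp add: r0_def card_of_Card_order)
  have F: "Field r0 = UNIV" by (simp add: r0_def Field_card_of)
  have seg: "{z. (z, y) \<in> r0 - Id} = underS r0 y" for y by (auto simp: underS_def)
  have "countable (underS r0 y)" for y
  proof (rule ccontr)
    assume unc: "uncountable (underS r0 y)"
    obtain h :: "(nat \<Rightarrow> nat option) \<Rightarrow> real" where h: "inj h"
      using lepoll_nat_option_reals unfolding lepoll_def by blast
    then have hS: "underS r0 y \<approx> h ` underS r0 y"
      by (meson eqpoll_sym inj_on_image_eqpoll_self inj_on_subset subset_UNIV)
    then have "uncountable (h ` underS r0 y)"
      using unc countable_lepoll eqpoll_imp_lepoll by blast
    then have "h ` underS r0 y \<approx> (UNIV :: real set)" using assms by (simp add: CH_def)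
    then have "(UNIV :: (nat \<Rightarrow> nat option) set) \<lesssim> underS r0 y"
      using lepoll_nat_option_reals hS by (meson eqpoll_sym eqpoll_trans lepoll_trans2)
    moreover have "underS r0 y \<lesssim> (UNIV :: (nat \<Rightarrow> nat option) set)"
      by (simp add: subset_imp_lepoll)
    ultimately have "underS r0 y \<approx> (UNIV :: (nat \<Rightarrow> nat option) set)"
      by (simp add: lepoll_antisym)
    then have "ordIso2 (card_of (underS r0 y)) r0"
      by (simp add: eqpoll_iff_card_of_ordIso r0_def)
    then show False using card_of_underS[OF card, of y] F not_ordLess_ordIso by blast
  qed
  then show thesis
    using that[of "r0 - Id"] W unfolding seg
    by (auto simp: well_order_on_def linear_order_on_def total_on_def)
qed

section \<open>Transfinite construction of an almost disjoint family\<close>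

lemma infinite_almost_disjoint_set:
  assumes AD: "AD_family \<C>" and \<C>: "countable \<C>" "infinite \<C>"
  obtains B where "infinite B" "\<And>A. A \<in> \<C> \<Longrightarrow> finite (A \<inter> B)"
proof -
  define C where "C = from_nat_into \<C>"
  have C: "bij_betw C UNIV \<C>" unfolding C_def using \<C> by (rule bij_betw_from_nat_into)
  have inC: "C k \<in> \<C>" for k using C by (auto simp: bij_betw_def)
  have "\<exists>n. n \<in> C k - (\<Union>i<k. C i)" for k
  proof -
    have "finite (C k \<inter> C i)" if "i < k" for i
      using AD inC C that unfolding AD_family_def bij_betw_def inj_on_def by (metis UNIV_I less_irrefl)
    then have "finite (\<Union>i<k. C k \<inter> C i)" by blast
    moreover have "infinite (C k)" using AD inC by (auto simp: AD_family_def)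
    ultimately have "infinite (C k - (\<Union>i<k. C k \<inter> C i))" by simp
    then obtain n where "n \<in> C k - (\<Union>i<k. C k \<inter> C i)" by (metis ex_in_conv finite.emptyI)
    then show ?thesis by blast
  qed
  \<comment> \<open>Diagonal choice: \<open>s m\<close> avoids every \<open>C k\<close> with
    \<open>k < m\<close>, so \<open>C k\<close> contains at most the terms up to
    \<open>s k\<close>.\<close>
  then obtain s where s: "\<And>k. s k \<in> C k - (\<Union>i<k. C i)" by metis
  have "s m \<noteq> s k" if "m < k" for m k using s[of k] s[of m] that by auto
  then have "inj s" by (metis injI linorder_neqE_nat)
  then have "infinite (range s)" by (rule range_inj_infinite)
  moreover have "finite (A \<inter> range s)" if A: "A \<in> \<C>" for A
  proof -
    obtain k where k: "A = C k" using C A by (auto simp: bij_betw_def)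
    have "A \<inter> range s \<subseteq> s ` {..k}"
    proof
      fix n assume "n \<in> A \<inter> range s"
      then obtain m where m: "n = s m" "s m \<in> C k" using k by blast
      then have "m \<le> k" using s[of m] by (auto simp: not_less[symmetric])
      then show "n \<in> s ` {..k}" using m by blast
    qed
    then show ?thesis using finite_subset by blast
  qed
  ultimately show thesis using that by blast
qed

text \<open>The vertical lines of the plane, coded as a partition of the naturals. This countable
  family yields the non-boring space, and it starts the transfinite construction, where it keeps the
  family of earlier sets infinite.\<close>

definition columns :: "nat set set" where
  "columns = range (\<lambda>i. range (\<lambda>j. prod_encode (i, j)))"

lemma columns: "AD_family columns" "countable columns" "infinite columns"
proof -
  have inf: "infinite (range (\<lambda>j. prod_encode (i, j)))" for i
    by (rule range_inj_infinite) (auto intro: injI)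
  have dis: "range (\<lambda>j. prod_encode (i, j)) \<inter> range (\<lambda>j. prod_encode (i', j)) = {}"
    if "i \<noteq> i'" for i i'
    using that by auto
  show "AD_family columns"
    unfolding AD_family_def columns_def
  proof (intro conjI ballI impI)
    fix A B :: "nat set"
    assume "A \<in> range (\<lambda>i. range (\<lambda>j. prod_encode (i, j)))"
      and "B \<in> range (\<lambda>i. range (\<lambda>j. prod_encode (i, j)))" and "A \<noteq> B"
    then obtain i i' where "A = range (\<lambda>j. prod_encode (i, j))"
        "B = range (\<lambda>j. prod_encode (i', j))" "i \<noteq> i'"
      by blast
    then have "A \<inter> B = {}" using dis by simp
    then show "finite (A \<inter> B)" by simp
  qed (use inf in auto)
  show "countable columns" by (simp add: columns_def)
  have "inj (\<lambda>i. range (\<lambda>j. prod_encode (i, j)))"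
  proof (rule injI)
    fix i i' assume "range (\<lambda>j. prod_encode (i, j)) = range (\<lambda>j. prod_encode (i', j))"
    then show "i = i'" using dis[of i i'] by auto
  qed
  then show "infinite columns" unfolding columns_def by (rule range_inj_infinite)
qed

text \<open>The family is built along a well-order of all partial functions \<open>y\<close> on the ideal's ground
  set with countable initial segments. Stage \<open>y\<close> adds the image under \<open>y\<close> of a positive set on
  which \<open>y\<close> is finite-to-one whenever that image can be made almost disjoint from the earlier sets,
  so that \<open>y\<close> converges to the point it adds.\<close>

lemma CH_uncountable_mrowka:
  fixes I :: "'a set set"
  assumes CH and I: "is_ideal I X" and unb: "unboring_ideal I X"
  obtains \<A> where "AD_family \<A>" "uncountable \<A>" "FinBW (mrowka \<A>) I X"
proof -
  obtain r :: "((nat \<Rightarrow> nat option) \<times> (nat \<Rightarrow> nat option)) set" where wf: "wf r"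
    and tot: "\<And>y z. y \<noteq> z \<Longrightarrow> (y, z) \<in> r \<or> (z, y) \<in> r"
    and seg: "\<And>y. countable {z. (z, y) \<in> r}"
    by (rule CH_wellorder[OF \<open>CH\<close>]) (rule that)
  have X: "countable X" using I by (simp add: is_ideal_def)
  define e where "e = to_nat_on X"
  \<comment> \<open>An image consisting of \<open>Some\<close> values makes \<open>y\<close> defined
    throughout \<open>E\<close>.\<close>
  define img where "img y B \<longleftrightarrow> (\<exists>E\<subseteq>X. E \<notin> I \<and> fin_to_one (\<lambda>x. y (e x)) E
      \<and> (\<lambda>x. y (e x)) ` E = Some ` B)" for y :: "nat \<Rightarrow> nat option" and B
  have img_inf: "infinite B" if "img y B" for y B
  proof -
    obtain E where E: "E \<subseteq> X" "E \<notin> I" "fin_to_one (\<lambda>x. y (e x)) E" "(\<lambda>x. y (e x)) ` E = Some ` B"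
      using \<open>img y B\<close> unfolding img_def by blast
    have "infinite E" using E(1,2) ideal_finite[OF I] by blast
    then show ?thesis using fin_to_one_infinite_image[OF E(3)] E(4) by auto
  qed
  define prev where "prev f y = columns \<union> f ` {z. (z, y) \<in> r}"
    for f :: "(nat \<Rightarrow> nat option) \<Rightarrow> nat set" and y
  define ok where "ok \<C> B \<longleftrightarrow> infinite B \<and> (\<forall>A\<in>\<C>. finite (A \<inter> B))" for \<C> and B :: "nat set"
  \<comment> \<open>The implication keeps a choice possible at every stage: where no suitable image
    exists, any infinite set almost disjoint from the earlier ones is accepted.\<close>
  define P where "P f y B \<longleftrightarrow> ok (prev f y) B \<and> ((\<exists>B'. ok (prev f y) B' \<and> img y B') \<longrightarrow> img y B)"
    for f y B
  \<comment> \<open>An arbitrary set \<open>Z\<close> of stages covers both the initial segments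
    during the recursion and all stages at the end.\<close>
  have AD: "AD_family (columns \<union> f ` Z)" if Z: "\<And>z. z \<in> Z \<Longrightarrow> ok (prev f z) (f z)" for f Z
  proof -
    have col: "finite (A \<inter> f z)" if "A \<in> columns" "z \<in> Z" for A z
      using Z[OF that(2)] that(1) by (auto simp: ok_def prev_def)
    have "finite (f y \<inter> f z)" if "(y, z) \<in> r" "z \<in> Z" for y z
      using Z[OF that(2)] that(1) by (auto simp: ok_def prev_def)
    then have new: "finite (f y \<inter> f z)" if "y \<in> Z" "z \<in> Z" "f y \<noteq> f z" for y z
      using tot[of y z] that by (metis Int_commute)
    show ?thesis
      unfolding AD_family_def
    proof (intro conjI ballI impI)
      show "infinite A" if "A \<in> columns \<union> f ` Z" for A
        using that columns(1) Z by (auto simp: AD_family_def ok_def)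
      fix A B assume "A \<in> columns \<union> f ` Z" "B \<in> columns \<union> f ` Z" "A \<noteq> B"
      then consider "A \<in> columns" "B \<in> columns" | z where "A \<in> columns" "z \<in> Z" "B = f z"
        | z where "B \<in> columns" "z \<in> Z" "A = f z" | y z where "y \<in> Z" "z \<in> Z" "A = f y" "B = f z"
        by blast
      then show "finite (A \<inter> B)"
      proof cases
        case 1
        then show ?thesis using columns(1) \<open>A \<noteq> B\<close> by (simp add: AD_family_def)
      next
        case 2
        then show ?thesis using col by simp
      next
        case 3
        then show ?thesis using col by (simp add: Int_commute)
      next
        case 4
        then show ?thesis using new \<open>A \<noteq> B\<close> by simp
      qed
    qed
  qed
  have prev_countable: "countable (prev f y)" for f y
    using columns(2) seg[of y] by (simp add: prev_def)
  have "\<exists>f. \<forall>y. P f y (f y)"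
  proof (rule dependent_wf_choice[OF wf])
    fix f g :: "(nat \<Rightarrow> nat option) \<Rightarrow> nat set" and y B
    assume "\<And>z. (z, y) \<in> r \<Longrightarrow> f z = g z"
    then have "prev f y = prev g y" by (auto simp: prev_def)
    then show "P f y B = P g y B" by (simp add: P_def)
  next
    fix y f assume IH: "\<And>z. (z, y) \<in> r \<Longrightarrow> P f z (f z)"
    then have ADp: "AD_family (prev f y)" unfolding prev_def by (intro AD) (auto simp: P_def)
    have "infinite (prev f y)" using columns(3) by (simp add: prev_def)
    then obtain B where "ok (prev f y) B"
      using infinite_almost_disjoint_set[OF ADp prev_countable] unfolding ok_def by metis
    then show "\<exists>B. P f y B" unfolding P_def by blast
  qed
  then obtain f where f: "\<And>y. P f y (f y)" by blast
  then have ok: "ok (prev f y) (f y)" for y by (simp add: P_def)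
  define \<A> where "\<A> = columns \<union> range f"
  have ADA: "AD_family \<A>" unfolding \<A>_def by (rule AD) (rule ok)
  \<comment> \<open>The set added at a later stage is infinite but meets every earlier one finitely.
    So distinct stages add distinct sets, and there are uncountably many stages.\<close>
  have "f y \<noteq> f z" if "(y, z) \<in> r" for y z
  proof -
    have "finite (f y \<inter> f z)" "infinite (f z)" using ok[of z] that by (auto simp: ok_def prev_def)
    then show ?thesis by auto
  qed
  then have "inj f" using tot by (metis injI)
  then have "uncountable (range f)"
    using uncountable_nat_option countable_image_inj_on by blast
  then have unc: "uncountable \<A>" unfolding \<A>_def by simp
  have "FinBW (mrowka \<A>) I X"
  proof (rule FinBW_mrowkaI[OF I ADA])
    fix g :: "'a \<Rightarrow> phi_point"
    assume fib: "\<And>v. {x\<in>X. g x = v} \<in> I"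
      and N: "\<And>E. \<lbrakk>E \<subseteq> X; g ` E \<subseteq> - range PtN; fin_to_one g E\<rbrakk> \<Longrightarrow> E \<in> I"
      and A: "\<And>A E. \<lbrakk>A \<in> \<A>; E \<subseteq> X; g ` E \<subseteq> PtN ` A; fin_to_one g E\<rbrakk> \<Longrightarrow> E \<in> I"
    \<comment> \<open>All points other than some \<open>PtN k\<close> become \<open>None\<close>;
      along the enumeration of \<open>X\<close> this turns \<open>g\<close> into the stage
      \<open>y\<close> that takes care of it.\<close>
    define c where "c p = (case p of PtN k \<Rightarrow> Some k | _ \<Rightarrow> None)" for p
    have c_Some: "c p = Some k \<longleftrightarrow> p = PtN k" for p k by (cases p) (auto simp: c_def)
    define y where "y n = c (g (from_nat_into X n))" for n
    have y: "y (e x) = c (g x)" if "x \<in> X" for x using that X by (simp add: y_def e_def)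
    \<comment> \<open>Selection is available for countable families, so it is applied to the sets
      present before stage \<open>y\<close>.\<close>
    have "prev f y \<subseteq> \<A>" by (auto simp: prev_def \<A>_def)
    then have A': "\<And>A E. \<lbrakk>A \<in> prev f y; E \<subseteq> X; g ` E \<subseteq> PtN ` A; fin_to_one g E\<rbrakk> \<Longrightarrow> E \<in> I"
      using A by blast
    have "\<exists>E\<subseteq>X. E \<notin> I \<and> fin_to_one g E \<and> g ` E \<subseteq> range PtN
        \<and> (\<forall>A\<in>prev f y. finite {x\<in>E. g x \<in> PtN ` A})"
      using fib N A' by (rule unboring_ideal_mrowka_selection[OF I unb prev_countable])
    then obtain E where E: "E \<subseteq> X" "E \<notin> I" "fin_to_one g E" "g ` E \<subseteq> range PtN"
        "\<And>A. A \<in> prev f y \<Longrightarrow> finite {x\<in>E. g x \<in> PtN ` A}"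
      by blast
    \<comment> \<open>Shows that stage \<open>y\<close> did not fall back on an arbitrary set:
      \<open>B\<close> is an image as required, almost disjoint from the earlier sets.\<close>
    define B where "B = PtN -` (g ` E)"
    have "img y B"
      unfolding img_def
    proof (intro exI conjI)
      show "fin_to_one (\<lambda>x. y (e x)) E"
        unfolding fin_to_one_def
      proof
        fix v
        show "finite {x\<in>E. y (e x) = v}"
        proof (cases v)
          case None
          have "y (e x) \<noteq> None" if "x \<in> E" for x
          proof -
            obtain k where "g x = PtN k" using E(4) \<open>x \<in> E\<close> by blast
            then show ?thesis using y[of x] E(1) \<open>x \<in> E\<close> by (auto simp: c_def)
          qed
          then have "{x\<in>E. y (e x) = v} = {}" using None by blast
          then show ?thesis by (simp only: finite.emptyI)
        next
          case (Some k)
          have "{x\<in>E. y (e x) = v} \<subseteq> {x\<in>E. g x = PtN k}" using Some E(1) y c_Some by auto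
          moreover have "finite {x\<in>E. g x = PtN k}" using E(3) by (simp add: fin_to_one_def)
          ultimately show ?thesis by (rule finite_subset)
        qed
      qed
      have "(\<lambda>x. y (e x)) ` E = (\<lambda>x. c (g x)) ` E" using E(1) y by (intro image_cong) auto
      also have "\<dots> = c ` (g ` E)" by auto
      also have "g ` E = PtN ` B" using E(4) by (simp add: B_def image_vimage_eq Int_absorb2)
      also have "c ` (PtN ` B) = Some ` B" by (simp add: image_image c_def)
      finally show "(\<lambda>x. y (e x)) ` E = Some ` B" .
    qed (use E in auto)
    moreover have "finite (A \<inter> B)" if "A \<in> prev f y" for A
    proof -
      have "PtN ` (A \<inter> B) \<subseteq> g ` {x\<in>E. g x \<in> PtN ` A}"
      proof
        fix p assume "p \<in> PtN ` (A \<inter> B)"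
        then obtain k x where "k \<in> A" "p = PtN k" "x \<in> E" "p = g x" by (auto simp: B_def)
        then show "p \<in> g ` {x\<in>E. g x \<in> PtN ` A}" by (intro image_eqI[of _ _ x]) auto
      qed
      then have "finite (PtN ` (A \<inter> B))" using E(5)[OF that] finite_subset by blast
      then show ?thesis by (rule finite_imageD) (simp add: inj_on_def)
    qed
    ultimately have "img y (f y)" using f[of y] img_inf[of y B] by (auto simp: P_def ok_def)
    then obtain E' where E': "E' \<subseteq> X" "E' \<notin> I" "fin_to_one (\<lambda>x. y (e x)) E'"
        "(\<lambda>x. y (e x)) ` E' = Some ` f y"
      unfolding img_def by blast
    have "g ` E' \<subseteq> PtN ` f y"
    proof
      fix p assume "p \<in> g ` E'"
      then obtain x where x: "x \<in> E'" "p = g x" by blast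
      then obtain k where "k \<in> f y" "y (e x) = Some k" using E'(4) by blast
      then show "p \<in> PtN ` f y" using x E'(1) y c_Some by auto
    qed
    moreover have "fin_to_one g E'"
      unfolding fin_to_one_def
    proof
      fix v
      have "{x\<in>E'. g x = v} \<subseteq> {x\<in>E'. y (e x) = c v}" using E'(1) y by auto
      moreover have "finite {x\<in>E'. y (e x) = c v}" using E'(3) by (simp add: fin_to_one_def)
      ultimately show "finite {x\<in>E'. g x = v}" by (rule finite_subset)
    qed
    \<comment> \<open>A positive set mapped finite-to-one into the member \<open>f y\<close>
      contradicts \<open>A\<close>, so no such \<open>g\<close> exists and the goal follows.\<close>
    ultimately have "E' \<in> I" using A[of "f y" E'] E'(1) by (simp add: \<A>_def)
    then show "\<exists>E\<subseteq>X. E \<notin> I \<and> fin_to_one g E \<and> (\<forall>A\<in>\<A>. finite {x\<in>E. g x \<in> PtN ` A})"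
      using E'(2) by blast
  qed
  then show thesis using that ADA unc by blast
qed

section \<open>Copies on a fixed type, and the equivalences\<close>

primrec phi_code :: "phi_point \<Rightarrow> nat set" where
  "phi_code (PtN n) = {Suc n}"
| "phi_code (PtA A) = insert 0 (Suc ` A)"
| "phi_code PtInf = {}"

text \<open>The element 0 marks the points \<open>PtA A\<close>, and the shift by \<open>Suc\<close>
  keeps it out of the codes of natural points.\<close>

lemma inj_phi_code: "inj phi_code"
proof (rule injI)
  fix p q assume "phi_code p = phi_code q"
  then show "p = q"
  proof (cases p; cases q)
    fix A B assume pq: "p = PtA A" "q = PtA B"
    then have "insert 0 (Suc ` A) = insert 0 (Suc ` B)" using \<open>phi_code p = phi_code q\<close> by simp
    then have "Suc ` A = Suc ` B" by (metis Diff_insert_absorb image_iff nat.distinct(1))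
    then show "p = q" using pq by (simp add: inj_image_eq_iff)
  qed auto
qed

lemma nat_set_copy:
  fixes T :: "phi_point topology"
  obtains T' :: "nat set topology" and f g where "homeomorphic_maps T T' f g"
  using homeomorphic_maps_pullback_topology[OF inj_phi_code, of T] by blast

text \<open>One formula cannot quantify over spaces of all types. For spaces in general, the forward
  implications therefore give a witness on the fixed type \<open>nat set\<close>, while the
  converses hold for arbitrary types \<open>'b\<close> and \<open>'c\<close>.\<close>

theorem theorem6p6:
  fixes I :: "'a set set" and X :: "'a set"
  assumes "is_ideal I X"
  shows
    "(unboring_ideal I X \<longrightarrow>
        (\<exists>T::nat set topology. FinBW T I X \<and> \<not> boring_space T))
   \<and> (\<forall>T::'b topology. FinBW T I X \<and> \<not> boring_space T \<longrightarrow> unboring_ideal I X)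
   \<and> (CH \<longrightarrow>
        (unboring_ideal I X \<longleftrightarrow>
           (\<exists>\<A>. AD_family \<A> \<and> infinite \<A> \<and> uncountable (topspace (mrowka \<A>))
                 \<and> FinBW (mrowka \<A>) I X))
      \<and> (unboring_ideal I X \<longrightarrow>
           (\<exists>T::nat set topology. uncountable (topspace T) \<and> separable_space T
                 \<and> FinBW T I X))
      \<and> (\<forall>T::'c topology. uncountable (topspace T) \<and> separable_space T \<and> FinBW T I X
           \<longrightarrow> unboring_ideal I X))"
proof -
  have "\<exists>T::nat set topology. FinBW T I X \<and> \<not> boring_space T" if "unboring_ideal I X"
  proof -
    obtain T :: "nat set topology" and f g where "homeomorphic_maps (mrowka columns) T f g"
      by (rule nat_set_copy)
    then show ?thesis
      using FinBW_homeomorphic boring_space_homeomorphic not_boring_space_mrowka[OF columns(1,3)]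
        FinBW_mrowka_countable[OF assms that columns(1,2)]
      by blast
  qed
  moreover have "unboring_ideal I X" if "FinBW T I X" "\<not> boring_space T" for T :: "'b topology"
    using boring_space_if_boring_ideal[OF assms] that unfolding unboring_ideal_def by blast
  moreover have CH_mrowka: "\<exists>\<A>. AD_family \<A> \<and> infinite \<A> \<and> uncountable (topspace (mrowka \<A>))
      \<and> FinBW (mrowka \<A>) I X" if "CH" "unboring_ideal I X"
  proof -
    obtain \<A> where \<A>: "AD_family \<A>" "uncountable \<A>" "FinBW (mrowka \<A>) I X"
      using CH_uncountable_mrowka[OF \<open>CH\<close> assms \<open>unboring_ideal I X\<close>] by blast
    have "uncountable (PtA ` \<A>)"
      using \<A>(2) countable_image_inj_on[of PtA \<A>] by (auto simp: inj_on_def)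
    then have "uncountable (topspace (mrowka \<A>))"
      using countable_subset[of "PtA ` \<A>" "topspace (mrowka \<A>)"] by (auto simp: topspace_mrowka)
    then show ?thesis using \<A> uncountable_infinite by blast
  qed
  moreover have "unboring_ideal I X" if "AD_family \<A>" "infinite \<A>"
      "uncountable (topspace (mrowka \<A>))" "FinBW (mrowka \<A>) I X" for \<A>
    using unboring_ideal_if_uncountable_separable[OF assms that(4) _ that(3)]
      separable_space_mrowka that(1,2) by blast
  moreover have "\<exists>T::nat set topology. uncountable (topspace T) \<and> separable_space T \<and> FinBW T I X"
    if unb: "CH" "unboring_ideal I X"
  proof -
    obtain \<A> where \<A>: "AD_family \<A>" "infinite \<A>" "uncountable (topspace (mrowka \<A>))"
        "FinBW (mrowka \<A>) I X"
      using CH_mrowka[OF unb] by blast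
    obtain T :: "nat set topology" and f g where T: "homeomorphic_maps (mrowka \<A>) T f g"
      by (rule nat_set_copy)
    then have "g ` topspace T = topspace (mrowka \<A>)"
      by (metis homeomorphic_imp_surjective_map homeomorphic_maps_map homeomorphic_maps_sym)
    then have "uncountable (topspace T)" using \<A>(3) by (metis countable_image)
    moreover have "separable_space T"
      using separable_space_mrowka[OF \<A>(1,2)] T homeomorphic_separable_space
      unfolding homeomorphic_space_def by blast
    ultimately show ?thesis using FinBW_homeomorphic[OF T \<A>(4)] by blast
  qed
  moreover have "unboring_ideal I X"
    if "uncountable (topspace T)" "separable_space T" "FinBW T I X" for T :: "'c topology"
    using unboring_ideal_if_uncountable_separable[OF assms that(3,2,1)] .
  ultimately show ?thesis by (metis (no_types, lifting))
qed

end
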